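(* Let $A=A_s+A_d\epsilon\in\mathbb{DC}^{m\times n}$. Then the DMPGI of $A$ exists if and only if all nonzero singular values of $A$ are appreciable (i.e. $A$ has no positive infinitesimal singular values). Furthermore, in that case, if $A=U\Sigma V^*$ is an SVD of $A$ with $\Sigma=\mathrm{diag}(\Sigma_r,O_{m-r,n-r})$, $\Sigma_r=\mathrm{diag}(\mu_1,\dots,\mu_r)$ with $\mu_1,\dots,\mu_r$ appreciable, then $$A^D=V\begin{bmatrix}\Sigma_r^{-1}&O\\O&O\end{bmatrix}U^*.$$
   Context: A dual number is $a=a_s+a_d\epsilon$ where $\epsilon\neq0$, $\epsilon^2=0$, and $\epsilon$ commutes with real/complex numbers; it is appreciable if $a_s\neq0$ and infinitesimal otherwise. For appreciable $\mu$, $\mu^{-1}=\mu_s^{-1}-\mu_s^{-2}\mu_d\epsilon$. For a dual complex matrix $A=A_s+A_d\epsilon$, $A^*=A_s^*+A_d^*\epsilon$; unitary means $U^*U=UU^*=I$. Every $A\in\mathbb{DC}^{m\times n}$ has an SVD $A=U\Sigma V^*$ with $U\in\mathbb{DC}^{m\times m},V\in\mathbb{DC}^{n\times n}$ unitary and $\Sigma\in\mathbb{D}^{m\times n}$ diagonal with diagonal entries $\mu_1\ge\dots\ge\mu_r$ positive appreciable dual reals, $\mu_{r+1}\ge\dots\ge\mu_t$ positive infinitesimal dual reals, and zeros, $r\le t\le\min\{m,n\}$; these singular values are unique (order on dual reals: $a>b$ iff $a_s>b_s$, or $a_s=b_s$ and $a_d>b_d$). The dual Moore–Penrose generalized inverse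 (DMPGI) of $A$, denoted $A^D$, is a matrix $X\in\mathbb{DC}^{n\times m}$ satisfying $AXA=A$, $XAX=X$, $(AX)^*=AX$, $(XA)^*=XA$. *)

theory Defs
  imports Complex_Main "Jordan_Normal_Form.Matrix"
begin

text \<open>A dual complex matrix A = A_s + A_d eps is represented by the pair (A_s, A_d)
 of complex matrices of equal dimensions. A dual number a = a_s + a_d eps is the pair (a_s, a_d).\<close>

type_synonym dcmat = "complex mat \<times> complex mat"

definition ctrans :: "complex mat \<Rightarrow> complex mat" where
  "ctrans A = mat (dim_col A) (dim_row A) (\<lambda>(i,j). cnj (A $$ (j,i)))"

definition dcarrier :: "nat \<Rightarrow> nat \<Rightarrow> dcmat set" where
  "dcarrier m n = {(As, Ad). As \<in> carrier_mat m n \<and> Ad \<in> carrier_mat m n}"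

text \<open>Product: (A_s + A_d eps)(B_s + B_d eps) = A_s B_s + (A_s B_d + A_d B_s) eps, since eps^2 = 0.\<close>
definition dmult :: "dcmat \<Rightarrow> dcmat \<Rightarrow> dcmat" (infixl "**\<^sub>d" 70) where
  "dmult A B = (fst A * fst B, fst A * snd B + snd A * fst B)"

definition dstar :: "dcmat \<Rightarrow> dcmat" where
  "dstar A = (ctrans (fst A), ctrans (snd A))"

definition dident :: "nat \<Rightarrow> dcmat" where
  "dident n = (1\<^sub>m n, 0\<^sub>m n n)"

definition dunitary :: "nat \<Rightarrow> dcmat \<Rightarrow> bool" where
  "dunitary n U \<longleftrightarrow> U \<in> dcarrier n n \<and> dstar U **\<^sub>d U = dident n \<and> U **\<^sub>d dstar U = dident n"

definition dentry :: "dcmat \<Rightarrow> nat \<Rightarrow> nat \<Rightarrow> complex \<times> complex" where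
  "dentry A i j = (fst A $$ (i,j), snd A $$ (i,j))"

definition dreal_less :: "real \<times> real \<Rightarrow> real \<times> real \<Rightarrow> bool" where
  "dreal_less a b \<longleftrightarrow> fst a < fst b \<or> (fst a = fst b \<and> snd a < snd b)"

definition dreal_le :: "real \<times> real \<Rightarrow> real \<times> real \<Rightarrow> bool" where
  "dreal_le a b \<longleftrightarrow> dreal_less a b \<or> a = b"

definition appreciable :: "complex \<times> complex \<Rightarrow> bool" where
  "appreciable a \<longleftrightarrow> fst a \<noteq> 0"

definition dual_svd :: "nat \<Rightarrow> nat \<Rightarrow> dcmat \<Rightarrow> dcmat \<Rightarrow> dcmat \<Rightarrow> dcmat \<Rightarrow> bool" where
  "dual_svd m n A U S V \<longleftrightarrow>
     dunitary m U \<and> dunitary n V \<and> S \<in> dcarrier m n \<and>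
     (\<forall>i<m. \<forall>j<n. fst S $$ (i,j) \<in> \<real> \<and> snd S $$ (i,j) \<in> \<real>) \<and>
     (\<forall>i<m. \<forall>j<n. i \<noteq> j \<longrightarrow> dentry S i j = (0,0)) \<and>
     (\<exists>r t. r \<le> t \<and> t \<le> min m n \<and>
        (\<forall>i<r. Re (fst S $$ (i,i)) > 0) \<and>
        (\<forall>i. r \<le> i \<and> i < t \<longrightarrow> fst S $$ (i,i) = 0 \<and> Re (snd S $$ (i,i)) > 0) \<and>
        (\<forall>i. t \<le> i \<and> i < min m n \<longrightarrow> dentry S i i = (0,0)) \<and>
        (\<forall>i j. i \<le> j \<and> j < t \<longrightarrow>
            dreal_le (Re (fst S $$ (j,j)), Re (snd S $$ (j,j)))
                     (Re (fst S $$ (i,i)), Re (snd S $$ (i,i))))) \<and>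
     A = U **\<^sub>d S **\<^sub>d dstar V"

definition is_DMPGI :: "nat \<Rightarrow> nat \<Rightarrow> dcmat \<Rightarrow> dcmat \<Rightarrow> bool" where
  "is_DMPGI m n A X \<longleftrightarrow> X \<in> dcarrier n m \<and>
     A **\<^sub>d X **\<^sub>d A = A \<and> X **\<^sub>d A **\<^sub>d X = X \<and>
     dstar (A **\<^sub>d X) = A **\<^sub>d X \<and> dstar (X **\<^sub>d A) = X **\<^sub>d A"

text \<open>The n x m dual matrix [Sigma_r^{-1} O; O O], using mu^{-1} = mu_s^{-1} - mu_s^{-2} mu_d eps.\<close>
definition sigma_r_pinv :: "nat \<Rightarrow> nat \<Rightarrow> nat \<Rightarrow> dcmat \<Rightarrow> dcmat" where
  "sigma_r_pinv m n r S =
     (mat n m (\<lambda>(i,j). if i = j \<and> i < r then inverse (fst S $$ (i,i)) else 0),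
      mat n m (\<lambda>(i,j). if i = j \<and> i < r
                         then - inverse (fst S $$ (i,i) * fst S $$ (i,i)) * snd S $$ (i,i) else 0))"

end

theory Submission
  imports Defs "Jordan_Normal_Form.Schur_Decomposition" "HOL-Library.Product_Lexorder"
    "HOL-Combinatorics.Permutations"
begin

text \<open>A Moore--Penrose inverse is unique by the usual Penrose computation and is transported by unitary
  equivalence, so with an SVD at hand everything is decided on a diagonal matrix \<open>\<Sigma>\<close>: there the
  appreciable entries are inverted, while for an infinitesimal entry \<open>\<mu>\<close> the equation
  \<open>\<Sigma> Y \<Sigma> = \<Sigma>\<close> would force \<open>\<mu> = \<mu> y \<mu> = 0\<close>.

  The substance is that a dual SVD exists. First diagonalise \<open>A\<^sub>s\<close> to a real \<open>S\<close>. Conjugating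
  \<open>S + B \<epsilon>\<close> with unitaries \<open>1 + P \<epsilon>\<close> and \<open>1 + Q \<epsilon>\<close>, where \<open>P\<close> and \<open>Q\<close> are skew-Hermitian,
  one can reach \<open>S + B' \<epsilon>\<close> with \<open>S\<^sup>* B'\<close> and \<open>B' S\<^sup>*\<close> Hermitian. For such a pair there is a common
  complex SVD with real diagonals, found by splitting off one common pair of singular vectors at a
  time. A signed permutation finally yields the required signs and order.\<close>

section \<open>Simultaneous singular value decomposition of complex matrices\<close>

lemma mult_assoc_dim:
  "dim_col A = dim_row B \<Longrightarrow> dim_col B = dim_row C \<Longrightarrow> A * B * C = A * (B * C)"
  for A B C :: "'a::semiring_0 mat"
  by (rule assoc_mult_mat[of A "dim_row A" "dim_row B" B "dim_row C" C "dim_col C"]) auto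

lemma mult_add_dim:
  "dim_col A = dim_row B \<Longrightarrow> dim_row B = dim_row C \<Longrightarrow> dim_col B = dim_col C \<Longrightarrow> A * (B + C) = A * B + A * C"
  for A B C :: "'a::semiring_0 mat"
  by (rule mult_add_distrib_mat[of A "dim_row A" "dim_row B" B "dim_col C" C]) auto

lemma add_mult_dim:
  "dim_col A = dim_row C \<Longrightarrow> dim_row A = dim_row B \<Longrightarrow> dim_col A = dim_col B \<Longrightarrow> (A + B) * C = A * C + B * C"
  for A B C :: "'a::semiring_0 mat"
  by (rule add_mult_distrib_mat[of A "dim_row A" "dim_col A" B C "dim_col C"]) auto

lemma smult_mult_dim: "dim_col A = dim_row B \<Longrightarrow> (c \<cdot>\<^sub>m A) * B = c \<cdot>\<^sub>m (A * B)"
  for A B :: "'a::comm_ring_1 mat"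
  by (rule mult_smult_assoc_mat[of A "dim_row A" "dim_row B" B "dim_col B"]) auto

lemma mult_smult_dim: "dim_col A = dim_row B \<Longrightarrow> A * (c \<cdot>\<^sub>m B) = c \<cdot>\<^sub>m (A * B)"
  for A B :: "'a::comm_ring_1 mat"
  by (rule mult_smult_distrib[of A "dim_row A" "dim_row B" B "dim_col B"]) auto

lemma smult_smult_mat: "c \<cdot>\<^sub>m (d \<cdot>\<^sub>m A) = (c * d) \<cdot>\<^sub>m A"
  for A :: "'a::comm_ring_1 mat"
  by (intro eq_matI) (auto simp: mult.assoc)

lemma one_smult_mat: "(1::'a::comm_ring_1) \<cdot>\<^sub>m A = A"
  by (intro eq_matI) auto

lemma zero_mult_dim: "dim_row A = k \<Longrightarrow> 0\<^sub>m n k * A = 0\<^sub>m n (dim_col A)"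
  for A :: "'a::semiring_0 mat"
  by (rule left_mult_zero_mat[of A k "dim_col A"]) auto

lemma mult_zero_dim: "dim_col A = k \<Longrightarrow> A * 0\<^sub>m k n = 0\<^sub>m (dim_row A) n"
  for A :: "'a::semiring_0 mat"
  by (rule right_mult_zero_mat[of A "dim_row A" k]) auto

text \<open>Many proofs below remove \<open>index_mult_mat(1)\<close> from the simpset: it would
  turn such an entry into a scalar product of a row and a column, whereas here the entry is to
  become an explicit sum or to stay opaque.\<close>

lemma index_mult_mat_sum:
  "i < dim_row A \<Longrightarrow> j < dim_col B \<Longrightarrow> dim_col A = dim_row B \<Longrightarrow>
    (A * B) $$ (i, j) = (\<Sum>k<dim_row B. A $$ (i, k) * B $$ (k, j))"
  by (simp add: scalar_prod_def atLeast0LessThan)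

text \<open>With dimension equations in place of carrier membership, the side conditions of these
  rules can be discharged by rewriting, without guessing any dimension.\<close>

lemmas mat_dim_simps = mult_assoc_dim mult_add_dim add_mult_dim smult_mult_dim mult_smult_dim
  smult_smult_mat zero_mult_dim mult_zero_dim

section \<open>The conjugate transpose and Gram matrices\<close>

lemma dim_ctrans[simp]: "dim_row (ctrans A) = dim_col A" "dim_col (ctrans A) = dim_row A"
  by (simp_all add: ctrans_def)

lemma index_ctrans[simp]: "i < dim_col A \<Longrightarrow> j < dim_row A \<Longrightarrow> ctrans A $$ (i, j) = cnj (A $$ (j, i))"
  by (simp add: ctrans_def)

lemma ctrans_carrier[simp]: "A \<in> carrier_mat m n \<Longrightarrow> ctrans A \<in> carrier_mat n m"
  by auto

lemma ctrans_ctrans[simp]: "ctrans (ctrans A) = A"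
  by (intro eq_matI) auto

lemma ctrans_mult: "dim_col A = dim_row B \<Longrightarrow> ctrans (A * B) = ctrans B * ctrans A"
  by (intro eq_matI) (simp_all add: index_mult_mat_sum mult.commute del: index_mult_mat(1))

lemma ctrans_add: "dim_row A = dim_row B \<Longrightarrow> dim_col A = dim_col B \<Longrightarrow> ctrans (A + B) = ctrans A + ctrans B"
  by (intro eq_matI) auto

lemma ctrans_smult: "ctrans (c \<cdot>\<^sub>m A) = cnj c \<cdot>\<^sub>m ctrans A"
  by (intro eq_matI) auto

lemma ctrans_one[simp]: "ctrans (1\<^sub>m n) = 1\<^sub>m n"
  by (intro eq_matI) auto

lemma ctrans_zero[simp]: "ctrans (0\<^sub>m m n) = 0\<^sub>m n m"
  by (intro eq_matI) auto

lemma ctrans_self_mult_diag: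
  "i < dim_col A \<Longrightarrow> (ctrans A * A) $$ (i, i) = complex_of_real (\<Sum>k<dim_row A. (cmod (A $$ (k, i)))\<^sup>2)"
  by (simp add: index_mult_mat_sum mult.commute flip: complex_norm_square del: index_mult_mat(1))

text \<open>A diagonal entry of \<open>A\<^sup>* A\<close> is the squared norm of a column of
  \<open>A\<close>, so a vanishing Gram matrix kills every column.\<close>

lemma ctrans_self_mult_eq_0:
  assumes "ctrans A * A = 0\<^sub>m k k"
  shows "A = 0\<^sub>m (dim_row A) k"
proof -
  have k: "k = dim_col A" using arg_cong[OF assms, of dim_row] by simp
  show ?thesis
  proof (intro eq_matI)
    fix i j assume *: "i < dim_row (0\<^sub>m (dim_row A) k :: complex mat)" "j < dim_col (0\<^sub>m (dim_row A) k :: complex mat)"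
    then have "complex_of_real (\<Sum>k<dim_row A. (cmod (A $$ (k, j)))\<^sup>2) = 0"
      using ctrans_self_mult_diag[of j A] assms k by simp
    then have "(\<Sum>k<dim_row A. (cmod (A $$ (k, j)))\<^sup>2) = 0" by (simp only: of_real_eq_0_iff)
    then have "(cmod (A $$ (i, j)))\<^sup>2 = 0" using * by (subst (asm) sum_nonneg_eq_0_iff) auto
    then show "A $$ (i, j) = 0\<^sub>m (dim_row A) k $$ (i, j)" using * by simp
  qed (use k in auto)
qed

section \<open>Trace and nonzero eigenvalues\<close>

definition mtrace :: "complex mat \<Rightarrow> complex" where
  "mtrace A = (\<Sum>i<dim_row A. A $$ (i, i))"

lemma mtrace_mult_commute:
  assumes "dim_col A = dim_row B" "dim_col B = dim_row A"
  shows "mtrace (A * B) = mtrace (B * A)"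
proof -
  have "mtrace (A * B) = (\<Sum>i<dim_row A. \<Sum>k<dim_row B. A $$ (i, k) * B $$ (k, i))"
    using assms by (simp add: mtrace_def index_mult_mat_sum del: index_mult_mat(1))
  also have "\<dots> = (\<Sum>k<dim_row B. \<Sum>i<dim_row A. B $$ (k, i) * A $$ (i, k))"
    by (subst sum.swap) (simp add: mult.commute)
  also have "\<dots> = mtrace (B * A)"
    using assms by (simp add: mtrace_def index_mult_mat_sum del: index_mult_mat(1))
  finally show ?thesis .
qed

text \<open>Schur decomposition makes \<open>N\<close> similar to a matrix whose diagonal lists the
  roots of the characteristic polynomial. Similarity preserves the trace, so some root is nonzero.
  The eigenvector is delivered as an n x 1 matrix to keep later computations inside matrix
  algebra.\<close>

lemma nonzero_eigenvalue_if_mtrace_nonzero: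
  assumes N: "N \<in> carrier_mat n n" and tr: "mtrace N \<noteq> 0"
  obtains l v where "l \<noteq> 0" "v \<in> carrier_mat n 1" "v \<noteq> 0\<^sub>m n 1" "N * v = l \<cdot>\<^sub>m v"
proof -
  obtain es where es: "char_poly N = (\<Prod>a\<leftarrow>es. [:- a, 1:])" using char_poly_factorized[OF N] by blast
  obtain B P Q where BPQ: "schur_decomposition N es = (B, P, Q)" by (cases "schur_decomposition N es") auto
  from schur_decomposition[OF N es BPQ]
  have sim: "similar_mat_wit N B P Q" and diag: "diag_mat B = es" by auto
  note D = similar_mat_witD2[OF N sim]
  have dims: "dim_row B = n" "dim_col B = n" "dim_row P = n" "dim_col P = n" "dim_row Q = n" "dim_col Q = n"
    using D by auto
  have "mtrace N = mtrace (P * (B * Q))" using D(3) dims by (simp add: mat_dim_simps)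
  also have "\<dots> = mtrace (B * Q * P)" by (rule mtrace_mult_commute) (auto simp: dims)
  also have "\<dots> = mtrace B" using D(2) dims by (simp add: mat_dim_simps)
  finally have "mtrace B \<noteq> 0" using tr by simp
  then obtain i where i: "i < n" "B $$ (i, i) \<noteq> 0" unfolding mtrace_def dims by (metis (no_types, lifting) lessThan_iff sum.neutral)
  define l where "l = B $$ (i, i)"
  have "l \<in> set es" using i dims unfolding diag[symmetric] l_def diag_mat_def by auto
  then have "poly (char_poly N) l = 0" unfolding es poly_prod_list by (auto simp: prod_list_zero_iff)
  then have "eigenvalue N l" using eigenvalue_root_char_poly[OF N] by simp
  then obtain v where v: "v \<in> carrier_vec n" "v \<noteq> 0\<^sub>v n" "N *\<^sub>v v = l \<cdot>\<^sub>v v"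
    using N unfolding eigenvalue_def eigenvector_def by auto
  define w where "w = mat n 1 (\<lambda>(i, j). v $ i)"
  have "w \<noteq> 0\<^sub>m n 1"
  proof
    assume "w = 0\<^sub>m n 1"
    then have "w $$ (i, 0) = 0" if "i < n" for i
      using that by simp
    then have "v $ i = 0" if "i < n" for i
      using that by (simp add: w_def)
    then show False using v by auto
  qed
  moreover have "N * w = l \<cdot>\<^sub>m w"
  proof (intro eq_matI)
    fix i j assume "i < dim_row (l \<cdot>\<^sub>m w)" "j < dim_col (l \<cdot>\<^sub>m w)"
    then have ij: "i < n" "j = 0" by (auto simp: w_def)
    have "col w 0 = v" using v by (intro eq_vecI) (auto simp: w_def)
    then have "(N * w) $$ (i, j) = (N *\<^sub>v v) $ i" using ij N by (simp add: w_def)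
    also have "\<dots> = (l \<cdot>\<^sub>m w) $$ (i, j)" unfolding v(3) using ij v by (simp add: w_def)
    finally show "(N * w) $$ (i, j) = (l \<cdot>\<^sub>m w) $$ (i, j)" .
  qed (use N in \<open>auto simp: w_def\<close>)
  ultimately show thesis using that[of l w] i l_def by (auto simp: w_def)
qed

section \<open>Complex unitary matrices and unit vectors\<close>

definition cunitary :: "nat \<Rightarrow> complex mat \<Rightarrow> bool" where
  "cunitary n U \<longleftrightarrow> U \<in> carrier_mat n n \<and> ctrans U * U = 1\<^sub>m n \<and> U * ctrans U = 1\<^sub>m n"

text \<open>The last two clauses cancel \<open>U\<close> against its adjoint inside right-nested
  products, the form to which \<open>mult_assoc_dim\<close> rewrites.\<close>

lemma cunitaryD:
  assumes "cunitary n U"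
  shows "dim_row U = n" "dim_col U = n" "ctrans U * U = 1\<^sub>m n" "U * ctrans U = 1\<^sub>m n"
    "dim_row X = n \<Longrightarrow> ctrans U * (U * X) = X" "dim_row X = n \<Longrightarrow> U * (ctrans U * X) = X"
proof -
  show *: "dim_row U = n" "dim_col U = n" "ctrans U * U = 1\<^sub>m n" "U * ctrans U = 1\<^sub>m n"
    using assms by (auto simp: cunitary_def)
  show "dim_row X = n \<Longrightarrow> ctrans U * (U * X) = X" "dim_row X = n \<Longrightarrow> U * (ctrans U * X) = X"
    using * by (simp_all add: mult_assoc_dim[symmetric])
qed

lemma cunitary_one: "cunitary n (1\<^sub>m n)"
  by (simp add: cunitary_def)

lemma cunitary_mult:
  assumes "cunitary n U" "cunitary n W"
  shows "cunitary n (U * W)"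
  unfolding cunitary_def
  by (simp add: cunitaryD[OF assms(1)] cunitaryD[OF assms(2)] ctrans_mult mult_assoc_dim carrier_matI)

definition first_unit :: "nat \<Rightarrow> complex mat" where
  "first_unit n = mat n 1 (\<lambda>(i, j). if i = 0 then 1 else 0)"

lemma dim_first_unit[simp]: "dim_row (first_unit n) = n" "dim_col (first_unit n) = 1"
  by (simp_all add: first_unit_def)

text \<open>The witness is a scalar times the Householder reflection in \<open>w = v - \<alpha> e\<^sub>0\<close>, where the
  phase \<open>\<alpha>\<close> makes \<open>cnj \<alpha> v\<^sub>0 = - \<bar>v\<^sub>0\<bar>\<close>, so that \<open>w\<close> cannot vanish.\<close>
lemma unitary_with_first_column:
  assumes v: "v \<in> carrier_mat n 1" and unit: "ctrans v * v = 1\<^sub>m 1" and n: "n > 0"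
  obtains W where "cunitary n W" "W * first_unit n = v"
proof -
  define x where "x i = v $$ (i, 0)" for i
  define r where "r = cmod (x 0)"
  \<comment> \<open>If \<open>x 0 = 0\<close>, any phase works and \<open>1\<close> is
    chosen.\<close>
  define \<alpha> where "\<alpha> = (if x 0 = 0 then 1 else - x 0 / r)"
  define w where "w i = x i - (if i = 0 then \<alpha> else 0)" for i
  \<comment> \<open>This is 2 divided by the squared norm \<open>2 + 2 * r\<close> of
    \<open>w\<close>, so \<open>1 - c w w\<^sup>*\<close> is the reflection exchanging
    \<open>v\<close> and \<alpha> times the first unit vector. Multiplying it by \<alpha> sends the
    first unit vector itself to \<open>v\<close>.\<close>
  define c where "c = (1 / (1 + r))"
  define H where "H = mat n n (\<lambda>(i, j). \<alpha> * ((if i = j then 1 else 0) - c * w i * cnj (w j)))"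
  have r0: "r \<ge> 0" by (simp add: r_def)
  have xx: "cnj (x 0) * x 0 = r * r" by (simp add: r_def complex_norm_square[symmetric] power2_eq_square[symmetric] mult.commute)
  have aa: "\<alpha> * cnj \<alpha> = 1" and ax: "\<alpha> * cnj (x 0) = - r" and xa: "cnj \<alpha> * x 0 = -r"
    using xx by (auto simp: \<alpha>_def r_def field_simps)
  have "(ctrans v * v) $$ (0, 0) = 1" using unit by simp
  then have s1: "(\<Sum>k<n. cnj (x k) * x k) = 1"
    using v by (simp add: index_mult_mat_sum x_def del: index_mult_mat(1))
  \<comment> \<open>Only the entry 0 changes: the phase contributes 1 and each of the two cross
    terms contributes \<open>r\<close>.\<close>
  have "cnj (w k) * w k = cnj (x k) * x k + (if k = 0 then complex_of_real (2 * r + 1) else 0)" for k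
    using aa ax xa by (auto simp: w_def algebra_simps)
  then have s: "(\<Sum>k<n. cnj (w k) * w k) = 2 + 2 * r"
    using n by (simp add: sum.distrib s1)
  have cs: "c * (2 + 2 * r) = 2" using r0 by (simp add: c_def field_simps)
  have cc: "complex_of_real c * (2 + 2 * r) = 2" using arg_cong[OF cs, of complex_of_real] by simp
  have HH: "H * ctrans H = 1\<^sub>m n"
  proof (intro eq_matI)
    fix i j assume "i < dim_row (1\<^sub>m n :: complex mat)" "j < dim_col (1\<^sub>m n :: complex mat)"
    then have ij: "i < n" "j < n" by auto
    let ?d = "\<lambda>i j :: nat. if i = j then 1 else 0 :: complex"
    have "(H * ctrans H) $$ (i, j) = (\<Sum>k<n. (\<alpha> * cnj \<alpha>) * ((?d i k - c * w i * cnj (w k)) * (?d k j - c * w k * cnj (w j))))"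
      using ij by (simp add: index_mult_mat_sum H_def del: index_mult_mat(1))
        (intro sum.cong refl, auto simp: algebra_simps)
    also have "\<dots> = (\<Sum>k<n. (if k = i then ?d i j - c * w i * cnj (w j) else 0)
        - (if k = j then c * w i * cnj (w j) else 0) + c * c * w i * cnj (w j) * (cnj (w k) * w k))"
      unfolding aa by (intro sum.cong refl) (auto simp: algebra_simps)
    also have "\<dots> = ?d i j - 2 * c * w i * cnj (w j) + c * w i * cnj (w j) * (c * (\<Sum>k<n. cnj (w k) * w k))"
      using ij by (simp add: sum.distrib sum_subtractf flip: sum_distrib_left)
    also have "\<dots> = ?d i j" unfolding s cc by simp
    finally show "(H * ctrans H) $$ (i, j) = 1\<^sub>m n $$ (i, j)" using ij by simp
  qed (auto simp: H_def)
  have Hc: "H \<in> carrier_mat n n" by (simp add: H_def)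
  have "cunitary n H"
    using HH Hc mat_mult_left_right_inverse[OF Hc _ HH] by (simp add: cunitary_def)
  moreover have "H * first_unit n = v"
  proof (intro eq_matI)
    fix i j assume "i < dim_row v" "j < dim_col v"
    then have ij: "i < n" "j = 0" using v by auto
    have "(H * first_unit n) $$ (i, 0) = H $$ (i, 0)"
      using ij Hc by (simp add: index_mult_mat_sum first_unit_def del: index_mult_mat(1))
        (subst sum.remove[of _ 0], auto)
    also have "\<dots> = \<alpha> * (if i = 0 then 1 else 0) - c * w i * (\<alpha> * cnj (x 0) - \<alpha> * cnj \<alpha>)"
      using ij n by (simp add: H_def algebra_simps) (simp add: w_def algebra_simps)
    also have "\<dots> = (if i = 0 then \<alpha> else 0) + w i * (c * (1 + r))" unfolding aa ax by (simp add: algebra_simps)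
    also have "c * (1 + r) = 1" using r0 by (simp add: c_def)
    also have "(if i = 0 then \<alpha> else 0) + w i * complex_of_real 1 = v $$ (i, 0)" by (simp add: w_def x_def)
    finally show "(H * first_unit n) $$ (i, j) = v $$ (i, j)" using ij by simp
  qed (use v Hc in auto)
  ultimately show thesis using that by blast
qed

lemma unit_multiple:
  assumes v: "v \<in> carrier_mat n 1" "v \<noteq> 0\<^sub>m n 1"
  obtains c where "ctrans (c \<cdot>\<^sub>m v) * (c \<cdot>\<^sub>m v) = 1\<^sub>m 1"
proof -
  define s where "s = (\<Sum>k<n. (cmod (v $$ (k, 0)))\<^sup>2)"
  have vv: "ctrans v * v = complex_of_real s \<cdot>\<^sub>m 1\<^sub>m 1"
    using v ctrans_self_mult_diag[of 0 v] by (intro eq_matI) (auto simp: s_def simp del: index_mult_mat(1))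
  have "s \<noteq> 0"
  proof
    assume "s = 0"
    then have "ctrans v * v = 0\<^sub>m 1 1" unfolding vv by (intro eq_matI) auto
    then show False using v ctrans_self_mult_eq_0[of v 1] by simp
  qed
  moreover have "s \<ge> 0" unfolding s_def by (intro sum_nonneg) simp
  ultimately have "(1 / sqrt s) * (1 / sqrt s) * s = 1" by (simp add: field_simps)
  then have "complex_of_real (1 / sqrt s) * complex_of_real (1 / sqrt s) * s = 1"
    by (metis of_real_1 of_real_mult)
  then have "ctrans (complex_of_real (1 / sqrt s) \<cdot>\<^sub>m v) * (complex_of_real (1 / sqrt s) \<cdot>\<^sub>m v) = 1\<^sub>m 1"
    by (simp add: ctrans_smult mat_dim_simps vv one_smult_mat mult.assoc del: of_real_divide)
  then show thesis by (rule that)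
qed

text \<open>The matrix \<open>N = A\<^sup>* A + i A\<^sup>* B\<close> is normal, so an eigenvector of \<open>N\<close> is one of both
  \<open>A\<^sup>* A\<close> and \<open>A\<^sup>* B\<close>; its eigenvalue can be taken nonzero since \<open>Re (tr N)\<close> is the
  squared Frobenius norm of \<open>A\<close>.\<close>
lemma common_singular_pair:
  assumes A: "A \<in> carrier_mat m n" and B: "B \<in> carrier_mat m n" and A0: "A \<noteq> 0\<^sub>m m n"
    and h1: "ctrans B * A = ctrans A * B" and h2: "B * ctrans A = A * ctrans B"
  obtains u v and a b :: real where "u \<in> carrier_mat m 1" "v \<in> carrier_mat n 1"
    "ctrans u * u = 1\<^sub>m 1" "ctrans v * v = 1\<^sub>m 1"
    "A * v = complex_of_real a \<cdot>\<^sub>m u" "ctrans A * u = complex_of_real a \<cdot>\<^sub>m v"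
    "B * v = complex_of_real b \<cdot>\<^sub>m u" "ctrans B * u = complex_of_real b \<cdot>\<^sub>m v"
proof -
  have dA[simp]: "dim_row A = m" "dim_col A = n" "dim_row B = m" "dim_col B = n" using A B by auto
  define H where "H = ctrans A * A"
  define K where "K = ctrans A * B"
  have dH[simp]: "dim_row H = n" "dim_col H = n" "dim_row K = n" "dim_col K = n" by (simp_all add: H_def K_def)
  have cH: "ctrans H = H" "ctrans K = K" by (simp_all add: H_def K_def ctrans_mult h1)
  \<comment> \<open>Being Hermitian and commuting, \<open>H\<close> and \<open>K\<close> will make
    \<open>N\<close> normal.\<close>
  have "K * H = ctrans A * ((B * ctrans A) * A)" by (simp add: H_def K_def mult_assoc_dim)
  also have "\<dots> = ctrans A * (A * (ctrans B * A))" unfolding h2 by (simp add: mult_assoc_dim)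
  also have "\<dots> = H * K" unfolding h1 by (simp add: H_def K_def mult_assoc_dim)
  finally have KH: "K * H = H * K" .
  define N where "N = H + \<i> \<cdot>\<^sub>m K"
  have dN[simp]: "dim_row N = n" "dim_col N = n" by (simp_all add: N_def)
  have Nc: "N \<in> carrier_mat n n" by (rule carrier_matI) simp_all
  have tr: "mtrace N \<noteq> 0"
  proof
    assume tr0: "mtrace N = 0"
    have "Im (K $$ (i, i)) = 0" if "i < n" for i
      using arg_cong[OF cH(2), of "\<lambda>X. Im (X $$ (i, i))"] that by simp
    then have "Re (N $$ (i, i)) = (\<Sum>k<m. (cmod (A $$ (k, i)))\<^sup>2)" if "i < n" for i
      using that ctrans_self_mult_diag[of i A] by (simp add: N_def H_def[symmetric] del: index_mult_mat(1))
    then have "(\<Sum>i<n. (\<Sum>k<m. (cmod (A $$ (k, i)))\<^sup>2)) = 0"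
      using arg_cong[OF tr0, of Re] by (simp add: mtrace_def)
    then have "\<forall>i<n. (\<Sum>k<m. (cmod (A $$ (k, i)))\<^sup>2) = 0"
      by (subst (asm) sum_nonneg_eq_0_iff) (auto intro: sum_nonneg)
    then have "\<forall>i<n. \<forall>k<m. A $$ (k, i) = 0"
      by (subst (asm) sum_nonneg_eq_0_iff) auto
    then have "A = 0\<^sub>m m n" by (intro eq_matI) auto
    with A0 show False by simp
  qed
  obtain l v0 where l: "l \<noteq> 0" and v0: "v0 \<in> carrier_mat n 1" "v0 \<noteq> 0\<^sub>m n 1" "N * v0 = l \<cdot>\<^sub>m v0"
    by (rule nonzero_eigenvalue_if_mtrace_nonzero[OF Nc tr])
  obtain c where c: "ctrans (c \<cdot>\<^sub>m v0) * (c \<cdot>\<^sub>m v0) = 1\<^sub>m 1" by (rule unit_multiple[OF v0(1,2)])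
  define v where "v = c \<cdot>\<^sub>m v0"
  have dv[simp]: "dim_row v = n" "dim_col v = 1" using v0 by (auto simp: v_def)
  have vv: "ctrans v * v = 1\<^sub>m 1" using c by (simp add: v_def)
  have Nv: "N * v = l \<cdot>\<^sub>m v" using v0 by (simp add: v_def mat_dim_simps mult.commute)
  \<comment> \<open>The shift \<open>M\<close> of \<open>N\<close> by \<open>l\<close> is normal
    too, so \<open>M v\<close> and \<open>M\<^sup>* v\<close> have the same norm; as
    \<open>M v = 0\<close>, also \<open>M\<^sup>* v = 0\<close>.\<close>
  define M where "M = N + (- l) \<cdot>\<^sub>m 1\<^sub>m n"
  have dM[simp]: "dim_row M = n" "dim_col M = n" by (simp_all add: M_def)
  have cM: "ctrans M = H + (-\<i>) \<cdot>\<^sub>m K + (- cnj l) \<cdot>\<^sub>m 1\<^sub>m n"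
    by (simp add: M_def N_def ctrans_add ctrans_smult cH)
  have normal: "M * ctrans M = ctrans M * M"
    unfolding cM unfolding M_def N_def
    by (intro eq_matI; simp add: mat_dim_simps KH del: index_mult_mat(1); simp add: algebra_simps del: index_mult_mat(1))
  have Mv: "M * v = 0\<^sub>m n 1"
    by (intro eq_matI; simp add: M_def mat_dim_simps Nv del: index_mult_mat(1))
  have "ctrans (ctrans M * v) * (ctrans M * v) = ctrans v * (M * ctrans M) * v"
    by (simp add: ctrans_mult mult_assoc_dim)
  also have "\<dots> = 0\<^sub>m 1 1" unfolding normal by (simp add: mult_assoc_dim Mv mult_zero_dim)
  finally have cMv: "ctrans M * v = 0\<^sub>m n 1" using ctrans_self_mult_eq_0 by fastforce
  \<comment> \<open>The eigenvalue equations of \<open>N\<close> and of its adjoint: their sum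
    isolates \<open>H v\<close> with eigenvalue \<open>Re l\<close>, their difference
    \<open>K v\<close> with eigenvalue \<open>Im l\<close>.\<close>
  have e1: "(H * v) $$ (i, 0) + \<i> * (K * v) $$ (i, 0) = l * v $$ (i, 0)" if "i < n" for i
    using arg_cong[OF Nv, of "\<lambda>X. X $$ (i, 0)"] that by (simp add: N_def mat_dim_simps del: index_mult_mat(1))
  have e2: "(H * v) $$ (i, 0) - \<i> * (K * v) $$ (i, 0) = cnj l * v $$ (i, 0)" if "i < n" for i
    using arg_cong[OF cMv, of "\<lambda>X. X $$ (i, 0)"] that by (simp add: cM mat_dim_simps algebra_simps del: index_mult_mat(1))
  have Hv: "H * v = complex_of_real (Re l) \<cdot>\<^sub>m v"
  proof (rule eq_matI)
    fix i j assume "i < dim_row (complex_of_real (Re l) \<cdot>\<^sub>m v)" "j < dim_col (complex_of_real (Re l) \<cdot>\<^sub>m v)"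
    then have ij: "i < n" "j = 0" by auto
    have "2 * (H * v) $$ (i, 0) = (l + cnj l) * v $$ (i, 0)"
      using e1[OF ij(1)] e2[OF ij(1)] by (simp add: algebra_simps del: index_mult_mat(1))
    then show "(H * v) $$ (i, j) = (complex_of_real (Re l) \<cdot>\<^sub>m v) $$ (i, j)"
      using ij by (simp add: complex_add_cnj del: index_mult_mat(1))
  qed auto
  have Kv: "K * v = complex_of_real (Im l) \<cdot>\<^sub>m v"
  proof (rule eq_matI)
    fix i j assume "i < dim_row (complex_of_real (Im l) \<cdot>\<^sub>m v)" "j < dim_col (complex_of_real (Im l) \<cdot>\<^sub>m v)"
    then have ij: "i < n" "j = 0" by auto
    have "2 * \<i> * (K * v) $$ (i, 0) = (l - cnj l) * v $$ (i, 0)"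
      using e1[OF ij(1)] e2[OF ij(1)] by (simp add: algebra_simps del: index_mult_mat(1))
    then show "(K * v) $$ (i, j) = (complex_of_real (Im l) \<cdot>\<^sub>m v) $$ (i, j)"
      using ij by (simp add: complex_diff_cnj del: index_mult_mat(1))
  qed auto
  define a where "a = Re l"
  define b where "b = Im l"
  have cAAv: "ctrans A * (A * v) = complex_of_real a \<cdot>\<^sub>m v"
    using Hv by (simp add: H_def a_def mult_assoc_dim)
  have cBAv: "ctrans B * (A * v) = complex_of_real b \<cdot>\<^sub>m v"
    using Kv by (simp add: K_def b_def mult_assoc_dim h1[symmetric])
  have AvAv: "ctrans (A * v) * (A * v) = complex_of_real a \<cdot>\<^sub>m 1\<^sub>m 1"
    by (simp add: ctrans_mult mult_assoc_dim cAAv mult_smult_dim vv)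
  have "a = (\<Sum>k<m. (cmod ((A * v) $$ (k, 0)))\<^sup>2)"
  proof -
    have "complex_of_real a = complex_of_real (\<Sum>k<m. (cmod ((A * v) $$ (k, 0)))\<^sup>2)"
      using ctrans_self_mult_diag[of 0 "A * v"] unfolding AvAv by (simp del: index_mult_mat(1))
    then show ?thesis by (simp only: of_real_eq_iff)
  qed
  then have "a \<ge> 0" by (simp add: sum_nonneg del: index_mult_mat(1))
  \<comment> \<open>If \<open>a = 0\<close> then \<open>A v = 0\<close>, hence
    \<open>b v = B\<^sup>* (A v) = 0\<close> and \<open>b = 0\<close>, contradicting
    \<open>l \<noteq> 0\<close>.\<close>
  moreover have "a \<noteq> 0"
  proof
    assume "a = 0"
    then have "ctrans (A * v) * (A * v) = 0\<^sub>m 1 1" unfolding AvAv by (intro eq_matI) auto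
    then have "A * v = 0\<^sub>m m 1" using ctrans_self_mult_eq_0 by fastforce
    then have bv: "complex_of_real b \<cdot>\<^sub>m v = 0\<^sub>m n 1" using cBAv by (simp add: mult_zero_dim)
    have "complex_of_real b \<cdot>\<^sub>m 1\<^sub>m 1 = ctrans v * (complex_of_real b \<cdot>\<^sub>m v)"
      by (simp add: mult_smult_dim vv)
    also have "\<dots> = 0\<^sub>m 1 1" unfolding bv by (simp add: mult_zero_dim)
    finally have "b = 0" by (metis index_one_mat(1) index_smult_mat(1) index_zero_mat(1) index_one_mat(2,3) less_one mult.right_neutral of_real_eq_0_iff)
    with \<open>a = 0\<close> l show False by (simp add: a_def b_def complex_eq_iff)
  qed
  ultimately have a: "a > 0" by simp
  \<comment> \<open>The squared norm of \<open>A v\<close> is \<open>a\<close>, so \<open>s\<close>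
    is the singular value and \<open>u\<close> is \<open>A v\<close> normalised.\<close>
  define s where "s = sqrt a"
  have s: "s > 0" "s * s = a" using a by (auto simp: s_def)
  define u where "u = complex_of_real (1 / s) \<cdot>\<^sub>m (A * v)"
  have du[simp]: "dim_row u = m" "dim_col u = 1" by (simp_all add: u_def)
  have r: "complex_of_real s * complex_of_real (1 / s) = 1" "complex_of_real (1 / s) * complex_of_real a = s"
      "complex_of_real (1 / s) * complex_of_real b = complex_of_real (b / s)"
      "complex_of_real (1 / s) * complex_of_real s = 1"
      "complex_of_real (b / s) * complex_of_real (1 / s) = b / a"
      "complex_of_real (1 / a) * complex_of_real a = 1"
      "complex_of_real (1 / a) * complex_of_real b = b / a"
    using s a unfolding of_real_mult[symmetric] of_real_eq_iff of_real_eq_1_iff by (auto simp: field_simps)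
  have Av: "A * v = complex_of_real s \<cdot>\<^sub>m u"
    by (simp only: u_def smult_smult_mat r one_smult_mat)
  \<comment> \<open>Rewriting \<open>a v\<close> as \<open>A\<^sup>* A v\<close> lets
    \<open>h2\<close> move the adjoint onto \<open>B\<close>, where
    \<open>B\<^sup>* A v = b v\<close> is known. Dividing by \<open>a\<close> gives
    \<open>B v\<close>.\<close>
  have "complex_of_real a \<cdot>\<^sub>m (B * v) = (B * ctrans A) * (A * v)"
    by (simp add: mult_assoc_dim cAAv mult_smult_dim)
  also have "\<dots> = complex_of_real b \<cdot>\<^sub>m (A * v)"
    unfolding h2 by (simp add: mult_assoc_dim cBAv mult_smult_dim)
  finally have "complex_of_real (1 / a) \<cdot>\<^sub>m (complex_of_real a \<cdot>\<^sub>m (B * v)) = complex_of_real (1 / a) \<cdot>\<^sub>m (complex_of_real b \<cdot>\<^sub>m (A * v))"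
    by simp
  then have Bv: "B * v = complex_of_real (b / s) \<cdot>\<^sub>m u"
    by (simp only: u_def smult_smult_mat r one_smult_mat)
  show thesis
  proof (rule that[of u v s "b / s"])
    show "ctrans u * u = 1\<^sub>m 1"
      by (simp only: u_def ctrans_smult)
        (simp add: smult_mult_dim mult_smult_dim smult_smult_mat AvAv r one_smult_mat del: of_real_divide)
    show "ctrans A * u = complex_of_real s \<cdot>\<^sub>m v" "ctrans B * u = complex_of_real (b / s) \<cdot>\<^sub>m v"
      by (simp_all add: u_def mult_smult_dim cAAv cBAv smult_smult_mat r del: of_real_divide)
  qed (use Av Bv vv in \<open>auto intro: carrier_matI\<close>)
qed

section \<open>Diagonal and bordered matrices\<close>

text \<open>Only the values of \<open>f\<close> below \<open>min m n\<close> matter. Keeping the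
  diagonal as a function makes sums, products and adjoints pointwise operations.\<close>

definition dmat :: "nat \<Rightarrow> nat \<Rightarrow> (nat \<Rightarrow> complex) \<Rightarrow> complex mat" where
  "dmat m n f = mat m n (\<lambda>(i, j). if i = j then f i else 0)"

lemma dim_dmat[simp]: "dim_row (dmat m n f) = m" "dim_col (dmat m n f) = n"
  by (simp_all add: dmat_def)

lemma index_dmat: "i < m \<Longrightarrow> j < n \<Longrightarrow> dmat m n f $$ (i, j) = (if i = j then f i else 0)"
  by (simp add: dmat_def)

text \<open>The block diagonal matrix with blocks \<open>a\<close> and \<open>M\<close>, for
  deflation.\<close>

definition bord :: "complex \<Rightarrow> complex mat \<Rightarrow> complex mat" where
  "bord a M = mat (Suc (dim_row M)) (Suc (dim_col M))
    (\<lambda>(i, j). case i of 0 \<Rightarrow> (case j of 0 \<Rightarrow> a | Suc _ \<Rightarrow> 0)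
                | Suc i' \<Rightarrow> (case j of 0 \<Rightarrow> 0 | Suc j' \<Rightarrow> M $$ (i', j')))"

lemma dim_bord[simp]: "dim_row (bord a M) = Suc (dim_row M)" "dim_col (bord a M) = Suc (dim_col M)"
  by (simp_all add: bord_def)

lemma bord_mult:
  assumes "dim_col M = dim_row N"
  shows "bord a M * bord b N = bord (a * b) (M * N)"
  using assms
  by (intro eq_matI)
    (auto simp: index_mult_mat_sum bord_def sum.lessThan_Suc_shift simp del: index_mult_mat(1) sum.lessThan_Suc split: nat.splits)

lemma bord_inject:
  assumes "bord a M = bord b N"
  shows "M = N"
proof -
  have d: "dim_row M = dim_row N" "dim_col M = dim_col N"
    using arg_cong[OF assms, of dim_row] arg_cong[OF assms, of dim_col] by simp_all
  have "M $$ (i, j) = N $$ (i, j)" if "i < dim_row N" "j < dim_col N" for i j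
    using arg_cong[OF assms, of "\<lambda>X. X $$ (Suc i, Suc j)"] d that by (simp add: bord_def)
  then show ?thesis using d by (intro eq_matI) auto
qed

lemma ctrans_bord: "ctrans (bord a M) = bord (cnj a) (ctrans M)"
  by (intro eq_matI) (auto simp: bord_def split: nat.splits)

lemma bord_one: "bord 1 (1\<^sub>m n) = 1\<^sub>m (Suc n)"
  by (intro eq_matI) (auto simp: bord_def split: nat.splits)

lemma bord_dmat: "bord a (dmat m n f) = dmat (Suc m) (Suc n) (case_nat a f)"
  by (intro eq_matI) (auto simp: bord_def dmat_def split: nat.splits)

lemma cunitary_bord: "cunitary n U \<Longrightarrow> cunitary (Suc n) (bord 1 U)"
  by (auto simp: cunitary_def ctrans_bord bord_mult bord_one intro!: carrier_matI)

text \<open>The first equation determines the first column of \<open>A\<close> and the second, after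
  conjugation, its first row; both vanish away from the corner.\<close>

lemma bord_of_first_unit:
  assumes A: "A \<in> carrier_mat (Suc m) (Suc n)"
    and c: "A * first_unit (Suc n) = a \<cdot>\<^sub>m first_unit (Suc m)"
    and r: "ctrans A * first_unit (Suc m) = cnj a \<cdot>\<^sub>m first_unit (Suc n)"
  obtains A' where "A' \<in> carrier_mat m n" "A = bord a A'"
proof
  have [simp]: "dim_row A = Suc m" "dim_col A = Suc n" using A by auto
  have e: "(X * first_unit k) $$ (i, 0) = X $$ (i, 0)" if "dim_col X = k" "i < dim_row X" "k > 0" for X k i
    using that by (simp add: index_mult_mat_sum first_unit_def del: index_mult_mat(1))
        (subst sum.remove[of _ 0], auto)
  have c': "A $$ (i, 0) = (if i = 0 then a else 0)" if "i < Suc m" for i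
    using e[of A "Suc n" i] that unfolding c by (auto simp: first_unit_def)
  have "cnj (A $$ (0, i)) = (if i = 0 then cnj a else 0)" if "i < Suc n" for i
    using e[of "ctrans A" "Suc m" i] that unfolding r by (auto simp: first_unit_def)
  then have r': "A $$ (0, i) = (if i = 0 then a else 0)" if "i < Suc n" for i
    using that by (metis complex_cnj_cancel_iff complex_cnj_zero)
  let ?A' = "mat m n (\<lambda>(i, j). A $$ (Suc i, Suc j))"
  show "?A' \<in> carrier_mat m n" by simp
  show "A = bord a ?A'"
    by (intro eq_matI) (auto simp: bord_def c' r' split: nat.splits)
qed

lemma cunitary_conj_cancel:
  assumes "cunitary m U" "cunitary n V" "A \<in> carrier_mat m n"
  shows "A = U * (ctrans U * A * V) * ctrans V"
  using assms(3) by (simp add: mult_assoc_dim cunitaryD[OF assms(1)] cunitaryD[OF assms(2)])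

text \<open>Deflation, by induction on the number of rows. Unitaries whose first columns form a
  common singular pair turn both matrices into bordered ones, and the two Hermitian conditions
  descend to the inner blocks. The diagonals are real but carry no sign or order yet.\<close>

lemma simultaneous_svd:
  assumes "A \<in> carrier_mat m n" "B \<in> carrier_mat m n"
    and "ctrans B * A = ctrans A * B" "B * ctrans A = A * ctrans B"
  shows "\<exists>U V f g. cunitary m U \<and> cunitary n V \<and>
    A = U * dmat m n (\<lambda>i. complex_of_real (f i)) * ctrans V \<and>
    B = U * dmat m n (\<lambda>i. complex_of_real (g i)) * ctrans V"
  using assms
proof (induction m arbitrary: n A B)
  case 0
  then have "A = 1\<^sub>m 0 * dmat 0 n (\<lambda>i. complex_of_real 0) * ctrans (1\<^sub>m n)"
    "B = 1\<^sub>m 0 * dmat 0 n (\<lambda>i. complex_of_real 0) * ctrans (1\<^sub>m n)"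
    by (auto intro!: eq_matI)
  then show ?case
    by (intro exI[of _ "1\<^sub>m 0"] exI[of _ "1\<^sub>m n"] exI[of _ "\<lambda>_. 0"] conjI cunitary_one)
next
  case (Suc m)
  show ?case
  proof (cases "A = 0\<^sub>m (Suc m) n \<and> B = 0\<^sub>m (Suc m) n")
    case True
    then have "A = 1\<^sub>m (Suc m) * dmat (Suc m) n (\<lambda>i. complex_of_real 0) * ctrans (1\<^sub>m n)"
      "B = 1\<^sub>m (Suc m) * dmat (Suc m) n (\<lambda>i. complex_of_real 0) * ctrans (1\<^sub>m n)"
      by (auto intro!: eq_matI simp: index_dmat)
    then show ?thesis
      by (intro exI[of _ "1\<^sub>m (Suc m)"] exI[of _ "1\<^sub>m n"] exI[of _ "\<lambda>_. 0"] conjI cunitary_one)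
  next
    case False
    have "\<exists>u v a b. u \<in> carrier_mat (Suc m) 1 \<and> v \<in> carrier_mat n 1 \<and>
      ctrans u * u = 1\<^sub>m 1 \<and> ctrans v * v = 1\<^sub>m 1 \<and>
      A * v = complex_of_real a \<cdot>\<^sub>m u \<and> ctrans A * u = complex_of_real a \<cdot>\<^sub>m v \<and>
      B * v = complex_of_real b \<cdot>\<^sub>m u \<and> ctrans B * u = complex_of_real b \<cdot>\<^sub>m v"
    proof (cases "A = 0\<^sub>m (Suc m) n")
      case True
      \<comment> \<open>The hypotheses are symmetric in the two matrices, so a zero \<open>A\<close>
        is handled by exchanging their roles.\<close>
      then have B0: "B \<noteq> 0\<^sub>m (Suc m) n" using False by simp
      show ?thesis
        by (rule common_singular_pair[OF Suc.prems(2,1) B0 Suc.prems(3)[symmetric] Suc.prems(4)[symmetric]]) blast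
    next
      case False
      show ?thesis
        by (rule common_singular_pair[OF Suc.prems(1,2) False Suc.prems(3,4)]) blast
    qed
    then obtain u v and a b :: real where u: "u \<in> carrier_mat (Suc m) 1" "ctrans u * u = 1\<^sub>m 1"
      and v: "v \<in> carrier_mat n 1" "ctrans v * v = 1\<^sub>m 1"
      and sv: "A * v = complex_of_real a \<cdot>\<^sub>m u" "ctrans A * u = complex_of_real a \<cdot>\<^sub>m v"
         "B * v = complex_of_real b \<cdot>\<^sub>m u" "ctrans B * u = complex_of_real b \<cdot>\<^sub>m v"
      by blast
    have "n \<noteq> 0"
    proof
      assume n0: "n = 0"
      have "(ctrans v * v) $$ (0, 0) = (0::complex)"
        using v(1) n0 by (simp add: index_mult_mat_sum del: index_mult_mat(1))
      then show False unfolding v(2) by simp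
    qed
    then obtain n' where n: "n = Suc n'" by (cases n) auto
    note dims[simp] = carrier_matD[OF Suc.prems(1)] carrier_matD[OF Suc.prems(2)]
    obtain U where U: "cunitary (Suc m) U" "U * first_unit (Suc m) = u"
      by (rule unitary_with_first_column[OF u]) auto
    obtain V where V: "cunitary n V" "V * first_unit n = v"
      by (rule unitary_with_first_column[OF v]) (auto simp: n)
    note UD = cunitaryD[OF U(1)] and VD = cunitaryD[OF V(1)]
    have Uu: "ctrans U * u = first_unit (Suc m)" and Vv: "ctrans V * v = first_unit n"
      unfolding U(2)[symmetric] V(2)[symmetric] by (simp_all add: UD VD)
    \<comment> \<open>\<open>U\<close> and \<open>V\<close> depend only on the pair
      \<open>u\<close>, \<open>v\<close>, so the same change of bases borders every matrix that has
      this singular pair.\<close>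
    have red: "\<exists>X'. X' \<in> carrier_mat m n' \<and> ctrans U * X * V = bord (complex_of_real x) X'"
      if X: "X \<in> carrier_mat (Suc m) n" and xv: "X * v = complex_of_real x \<cdot>\<^sub>m u"
        and xu: "ctrans X * u = complex_of_real x \<cdot>\<^sub>m v" for X x
    proof -
      have d: "dim_row X = Suc m" "dim_col X = n" "dim_row u = Suc m" "dim_row v = n" using X u v by auto
      have 1: "ctrans U * X * V \<in> carrier_mat (Suc m) (Suc n')"
        by (rule carrier_matI) (simp_all add: UD VD d n[symmetric])
      have 2: "ctrans U * X * V * first_unit (Suc n') = complex_of_real x \<cdot>\<^sub>m first_unit (Suc m)"
        by (simp add: n[symmetric] mult_assoc_dim UD VD d V(2) xv mult_smult_dim Uu)
      have 3: "ctrans (ctrans U * X * V) * first_unit (Suc m) = cnj (complex_of_real x) \<cdot>\<^sub>m first_unit (Suc n')"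
        by (simp add: n[symmetric] ctrans_mult mult_assoc_dim UD VD d U(2) xu mult_smult_dim Vv)
      show ?thesis by (rule bord_of_first_unit[OF 1 2 3]) blast
    qed
    obtain A' where A': "A' \<in> carrier_mat m n'" "ctrans U * A * V = bord (complex_of_real a) A'"
      using red[OF Suc.prems(1) sv(1,2)] by blast
    obtain B' where B': "B' \<in> carrier_mat m n'" "ctrans U * B * V = bord (complex_of_real b) B'"
      using red[OF Suc.prems(2) sv(3,4)] by blast
    have d': "dim_row A' = m" "dim_col A' = n'" "dim_row B' = m" "dim_col B' = n'" using A' B' by auto
    let ?A = "ctrans U * A * V" and ?B = "ctrans U * B * V"
    \<comment> \<open>Both conditions are invariant under a simultaneous unitary change of bases;
      comparing the inner blocks then gives them for \<open>A'\<close> and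
      \<open>B'\<close>.\<close>
    have "ctrans ?B * ?A = ctrans V * (ctrans B * A) * V"
      by (simp add: ctrans_mult mult_assoc_dim UD VD)
    also have "\<dots> = ctrans ?A * ?B"
      unfolding Suc.prems(3) by (simp add: ctrans_mult mult_assoc_dim UD VD)
    finally have h1: "ctrans B' * A' = ctrans A' * B'"
      unfolding A'(2) B'(2) by (simp add: ctrans_bord bord_mult d') (rule bord_inject)
    have "?B * ctrans ?A = ctrans U * (B * ctrans A) * U"
      by (simp add: ctrans_mult mult_assoc_dim UD VD)
    also have "\<dots> = ?A * ctrans ?B"
      unfolding Suc.prems(4) by (simp add: ctrans_mult mult_assoc_dim UD VD)
    finally have h2: "B' * ctrans A' = A' * ctrans B'"
      unfolding A'(2) B'(2) by (simp add: ctrans_bord bord_mult d') (rule bord_inject)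
    obtain U' V' f g where U': "cunitary m U'" and V': "cunitary n' V'"
      and AB': "A' = U' * dmat m n' (\<lambda>i. complex_of_real (f i)) * ctrans V'"
        "B' = U' * dmat m n' (\<lambda>i. complex_of_real (g i)) * ctrans V'"
      using Suc.IH[OF A'(1) B'(1) h1 h2] by blast
    note UD' = cunitaryD[OF U'] and VD' = cunitaryD[OF V']
    \<comment> \<open>The unitaries of the smaller problem, bordered by 1, leave the corner entry
      fixed and are composed with \<open>U\<close> and \<open>V\<close>.\<close>
    have comb: "X = (U * bord 1 U') * dmat (Suc m) n (\<lambda>i. complex_of_real (case_nat x h i)) * ctrans (V * bord 1 V')"
      if X: "X \<in> carrier_mat (Suc m) n" 
        and X1: "ctrans U * X * V = bord (complex_of_real x) (U' * dmat m n' (\<lambda>i. complex_of_real (h i)) * ctrans V')" for X x h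
    proof -
      have "(\<lambda>i. complex_of_real (case_nat x h i)) = case_nat (complex_of_real x) (\<lambda>i. complex_of_real (h i))"
        by (auto split: nat.splits)
      then have "ctrans U * X * V = bord 1 U' * dmat (Suc m) n (\<lambda>i. complex_of_real (case_nat x h i)) * ctrans (bord 1 V')"
        unfolding X1 by (simp add: n bord_dmat[symmetric] ctrans_bord bord_mult UD' VD')
      then have "X = U * (bord 1 U' * dmat (Suc m) n (\<lambda>i. complex_of_real (case_nat x h i)) * ctrans (bord 1 V')) * ctrans V"
        using cunitary_conj_cancel[OF U(1) V(1) X] by simp
      then show ?thesis by (simp add: ctrans_mult mult_assoc_dim UD VD UD' VD' n)
    qed
    have "cunitary n (V * bord 1 V')"
      using cunitary_mult[OF V(1)[unfolded n] cunitary_bord[OF V']] by (simp add: n)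
    then show ?thesis
      using comb[OF Suc.prems(1) A'(2)[unfolded AB']] comb[OF Suc.prems(2) B'(2)[unfolded AB']]
        cunitary_mult[OF U(1) cunitary_bord[OF U']]
      by (intro exI[of _ "U * bord 1 U'"] exI[of _ "V * bord 1 V'"] exI[of _ "case_nat a f"]
          exI[of _ "case_nat b g"] conjI)
  qed
qed

section \<open>Dual matrices\<close>

lemma add_zero_dim:
  "dim_row A = m \<Longrightarrow> dim_col A = n \<Longrightarrow> A + 0\<^sub>m m n = A"
  "dim_row A = m \<Longrightarrow> dim_col A = n \<Longrightarrow> 0\<^sub>m m n + A = A"
  for A :: "'a::monoid_add mat"
  by (auto intro!: eq_matI)

section \<open>Shapes, products and adjoints of dual matrices\<close>

text \<open>Splitting \<open>dcarrier\<close> into well-formedness and two dimension functions gives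
  the dual laws side conditions that the simplifier can discharge, as for complex matrices.\<close>

definition dwf :: "dcmat \<Rightarrow> bool" where
  "dwf A \<longleftrightarrow> dim_row (snd A) = dim_row (fst A) \<and> dim_col (snd A) = dim_col (fst A)"

definition drow :: "dcmat \<Rightarrow> nat" where "drow A = dim_row (fst A)"

definition dcol :: "dcmat \<Rightarrow> nat" where "dcol A = dim_col (fst A)"

lemmas ddim_defs = dwf_def drow_def dcol_def

lemma dcarrier_iff: "A \<in> dcarrier m n \<longleftrightarrow> dwf A \<and> drow A = m \<and> dcol A = n"
  by (cases A) (auto simp: dcarrier_def ddim_defs)

lemma ddim_dmult[simp]:
  "dwf A \<Longrightarrow> dwf B \<Longrightarrow> dcol A = drow B \<Longrightarrow> dwf (A **\<^sub>d B)"
  "drow (A **\<^sub>d B) = drow A" "dcol (A **\<^sub>d B) = dcol B"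
  by (simp_all add: ddim_defs dmult_def)

lemma ddim_dstar[simp]: "dwf (dstar A) = dwf A" "drow (dstar A) = dcol A" "dcol (dstar A) = drow A"
  by (auto simp: ddim_defs dstar_def)

lemma dmult_assoc:
  assumes "dwf A" "dwf B" "dwf C" "dcol A = drow B" "dcol B = drow C"
  shows "A **\<^sub>d B **\<^sub>d C = A **\<^sub>d (B **\<^sub>d C)"
  using assms
  by (auto simp: ddim_defs dmult_def mult_assoc_dim mult_add_dim add_mult_dim intro!: assoc_add_mat[of _ "drow A" "dcol C"] carrier_matI)

lemma dstar_dmult:
  assumes "dwf A" "dwf B" "dcol A = drow B"
  shows "dstar (A **\<^sub>d B) = dstar B **\<^sub>d dstar A"
  using assms
  by (auto simp: ddim_defs dmult_def dstar_def ctrans_mult ctrans_add intro!: comm_add_mat[of _ "dcol B" "drow A"] carrier_matI)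

lemma dstar_dstar[simp]: "dstar (dstar A) = A"
  by (simp add: dstar_def)

lemma dident_dmult: "dwf A \<Longrightarrow> drow A = n \<Longrightarrow> dident n **\<^sub>d A = A"
  by (cases A) (auto simp: ddim_defs dmult_def dident_def zero_mult_dim intro!: right_add_zero_mat[of _ n "dcol A"] carrier_matI)

section \<open>Dual unitary matrices and unitary equivalence\<close>

lemma dunitaryD:
  assumes "dunitary n U"
  shows "dwf U" "drow U = n" "dcol U = n" "dstar U **\<^sub>d U = dident n" "U **\<^sub>d dstar U = dident n"
    "dwf X \<Longrightarrow> drow X = n \<Longrightarrow> dstar U **\<^sub>d (U **\<^sub>d X) = X"
    "dwf X \<Longrightarrow> drow X = n \<Longrightarrow> U **\<^sub>d (dstar U **\<^sub>d X) = X"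
proof -
  show *: "dwf U" "drow U = n" "dcol U = n" "dstar U **\<^sub>d U = dident n" "U **\<^sub>d dstar U = dident n"
    using assms by (auto simp: dunitary_def dcarrier_iff)
  show "dwf X \<Longrightarrow> drow X = n \<Longrightarrow> dstar U **\<^sub>d (U **\<^sub>d X) = X"
    "dwf X \<Longrightarrow> drow X = n \<Longrightarrow> U **\<^sub>d (dstar U **\<^sub>d X) = X"
    using * by (simp_all add: dident_dmult flip: dmult_assoc)
qed

lemma dunitary_dstar: "dunitary n U \<Longrightarrow> dunitary n (dstar U)"
  by (simp add: dunitary_def dcarrier_iff)

lemma dunitary_dmult:
  assumes "dunitary n U" "dunitary n W"
  shows "dunitary n (U **\<^sub>d W)"
  unfolding dunitary_def dcarrier_iff
  by (simp add: dunitaryD[OF assms(1)] dunitaryD[OF assms(2)] dstar_dmult dmult_assoc)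

lemma dunitary_const:
  assumes "cunitary n U"
  shows "dunitary n (U, 0\<^sub>m n n)"
  using cunitaryD(1-4)[OF assms]
  by (auto simp: dunitary_def dmult_def dstar_def dident_def dcarrier_def mult_zero_dim zero_mult_dim intro!: carrier_matI)

text \<open>Since \<open>\<epsilon>\<close> squares to zero, \<open>(1 + P \<epsilon>)\<^sup>* (1 +
  P \<epsilon>) = 1 + (P\<^sup>* + P) \<epsilon>\<close>.\<close>

lemma dunitary_one_plus_skew:
  assumes "P \<in> carrier_mat n n" "P + ctrans P = 0\<^sub>m n n"
  shows "dunitary n (1\<^sub>m n, P)"
proof -
  have "ctrans P + P = 0\<^sub>m n n" using assms comm_add_mat[of P n n "ctrans P"] by simp
  then show ?thesis
    using assms comm_add_mat[of P n n "ctrans P"] by (auto simp: dunitary_def dmult_def dstar_def dident_def dcarrier_def)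
qed

text \<open>Oriented as a reduction of \<open>A\<close> to a simpler \<open>B\<close>, so that a
  chain of reductions ends in the factorisation that \<open>dual_svd\<close> asks for.\<close>

definition dequiv :: "nat \<Rightarrow> nat \<Rightarrow> dcmat \<Rightarrow> dcmat \<Rightarrow> bool" where
  "dequiv m n A B \<longleftrightarrow> B \<in> dcarrier m n \<and> (\<exists>U V. dunitary m U \<and> dunitary n V \<and> A = U **\<^sub>d B **\<^sub>d dstar V)"

lemma dequiv_trans:
  assumes "dequiv m n A B" "dequiv m n B C"
  shows "dequiv m n A C"
proof -
  obtain U V U' V' where *: "dunitary m U" "dunitary n V" "A = U **\<^sub>d B **\<^sub>d dstar V"
    "dunitary m U'" "dunitary n V'" "B = U' **\<^sub>d C **\<^sub>d dstar V'" and C: "C \<in> dcarrier m n"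
    using assms by (auto simp: dequiv_def)
  note D = dunitaryD[OF *(1)] dunitaryD[OF *(2)] dunitaryD[OF *(4)] dunitaryD[OF *(5)]
  have "A = (U **\<^sub>d U') **\<^sub>d C **\<^sub>d dstar (V **\<^sub>d V')"
    using C unfolding *(3,6) by (simp add: dcarrier_iff dmult_assoc dstar_dmult D)
  then show ?thesis using C dunitary_dmult * unfolding dequiv_def by blast
qed

lemma dequiv_const:
  assumes U: "cunitary m U" and V: "cunitary n V" and B: "B \<in> dcarrier m n"
  shows "dequiv m n (U * fst B * ctrans V, U * snd B * ctrans V) B"
proof -
  have d: "dim_row (fst B) = m" "dim_col (fst B) = n" "dim_row (snd B) = m" "dim_col (snd B) = n"
    using B by (auto simp: dcarrier_def)
  have "(U * fst B * ctrans V, U * snd B * ctrans V) = (U, 0\<^sub>m m m) **\<^sub>d B **\<^sub>d dstar (V, 0\<^sub>m n n)"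
    by (simp add: dmult_def dstar_def mult_zero_dim zero_mult_dim d cunitaryD(1,2)[OF U] cunitaryD(1,2)[OF V] add_zero_dim)
  then show ?thesis using B dunitary_const[OF U] dunitary_const[OF V] unfolding dequiv_def by blast
qed

text \<open>Expanding \<open>(1 + P \<epsilon>) (S + B' \<epsilon>) (1 + Q
  \<epsilon>)\<^sup>*\<close> leaves \<open>S\<close> unchanged and moves only the dual part. The
  summands of \<open>B\<close> stand in the order in which \<open>dmult\<close> produces
  them.\<close>

lemma dequiv_skew:
  assumes P: "P \<in> carrier_mat m m" "P + ctrans P = 0\<^sub>m m m" and Q: "Q \<in> carrier_mat n n" "Q + ctrans Q = 0\<^sub>m n n"
    and S: "S \<in> carrier_mat m n" "B' \<in> carrier_mat m n"
    and B: "B = S * ctrans Q + (B' + P * S)"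
  shows "dequiv m n (S, B) (S, B')"
proof -
  have "(S, B) = (1\<^sub>m m, P) **\<^sub>d (S, B') **\<^sub>d dstar (1\<^sub>m n, Q)"
    using S P(1) Q(1) unfolding B by (simp add: dmult_def dstar_def)
  then show ?thesis
    using S dunitary_one_plus_skew[OF P] dunitary_one_plus_skew[OF Q] unfolding dequiv_def dcarrier_def by blast
qed

section \<open>Products with diagonal matrices and reduction to a real diagonal\<close>

lemma mult_dmat_index:
  "dim_col X = m \<Longrightarrow> i < dim_row X \<Longrightarrow> j < n \<Longrightarrow>
    (X * dmat m n f) $$ (i, j) = (if j < m then X $$ (i, j) * f j else 0)"
  by (simp add: index_mult_mat_sum dmat_def del: index_mult_mat(1))
    (simp add: if_distrib cong: if_cong)

lemma dmat_mult_index: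
  "dim_row X = n \<Longrightarrow> i < m \<Longrightarrow> j < dim_col X \<Longrightarrow>
    (dmat m n f * X) $$ (i, j) = (if i < n then f i * X $$ (i, j) else 0)"
  by (simp add: index_mult_mat_sum dmat_def del: index_mult_mat(1))
    (simp add: if_distrib if_distribR cong: if_cong)

lemma dmat_cong: "(\<And>i. i < m \<Longrightarrow> i < n \<Longrightarrow> f i = g i) \<Longrightarrow> dmat m n f = dmat m n g"
  by (intro eq_matI) (auto simp: dmat_def)

lemma ctrans_dmat: "ctrans (dmat m n f) = dmat n m (\<lambda>i. cnj (f i))"
  by (intro eq_matI) (auto simp: dmat_def)

text \<open>The inner dimension \<open>n\<close> may be smaller than both outer ones, and diagonal
  positions from \<open>n\<close> on are then zero.\<close>

lemma dmat_mult_dmat: "dmat m n f * dmat n k g = dmat m k (\<lambda>i. if i < n then f i * g i else 0)"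
  by (intro eq_matI) (auto simp: dmat_mult_index index_dmat simp del: index_mult_mat(1))

lemma dmat_add_dmat: "dmat m n f + dmat m n g = dmat m n (\<lambda>i. f i + g i)"
  by (intro eq_matI) (auto simp: dmat_def)

text \<open>The matrices \<open>P S + S Q\<^sup>*\<close> with \<open>P, Q\<close> skew-Hermitian form the tangent space at \<open>S\<close> of the
  orbit of \<open>S\<close> under \<open>(U, V) \<mapsto> U S V\<^sup>*\<close>; the conditions on \<open>B'\<close> describe the normal space, so
  \<open>B'\<close> is the normal component of \<open>B\<close>. The formulas for \<open>p\<close> and \<open>q\<close> solve the equations entry pair
  by entry pair.\<close>
lemma tangent_normal_decomposition:
  assumes B: "B \<in> carrier_mat m n"
    and S_def: "S = dmat m n (\<lambda>i. complex_of_real (f i))"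
  obtains P Q B' where "P \<in> carrier_mat m m" "P + ctrans P = 0\<^sub>m m m" "Q \<in> carrier_mat n n" "Q + ctrans Q = 0\<^sub>m n n"
    "B' \<in> carrier_mat m n" "B = S * ctrans Q + (B' + P * S)"
    "ctrans B' * S = ctrans S * B'" "B' * ctrans S = S * ctrans B'"
proof -
  \<comment> \<open>\<open>P\<close> and \<open>Q\<close> are square of different sizes while
    \<open>B\<close> is m x n. Extending the diagonal and the entries of \<open>B\<close> by zero
    lets one formula serve all index pairs.\<close>
  define s where "s i = (if i < min m n then complex_of_real (f i) else 0)" for i
  have S: "S = dmat m n s" unfolding S_def by (rule dmat_cong) (simp add: s_def)
  have s0: "s i = 0" if "\<not> i < m \<or> \<not> i < n" for i using that by (auto simp: s_def)
  have cs[simp]: "cnj (s i) = s i" for i by (simp add: s_def)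
  define \<beta> where "\<beta> i j = (if i < m \<and> j < n then B $$ (i, j) else 0)" for i j
  \<comment> \<open>If the squares differ, \<open>p\<close> and \<open>q\<close> solve the two
    linear equations that make \<open>b i j\<close> and \<open>b j i\<close> vanish. If they agree
    and are nonzero, \<open>q = 0\<close> and \<open>p\<close> averages \<open>\<beta> i j\<close>
    with the conjugate of \<open>\<beta> j i\<close>, up to sign. If both are zero, the conditions
    on \<open>b\<close> are vacuous.\<close>
  define p where "p i j = (if s i ^ 2 \<noteq> s j ^ 2 then (s j * \<beta> i j + s i * cnj (\<beta> j i)) / (s j ^ 2 - s i ^ 2)
    else if s i = 0 then 0 else (s i * \<beta> i j - s j * cnj (\<beta> j i)) / (2 * s i * s j))" for i j
  define q where "q i j = (if s i ^ 2 \<noteq> s j ^ 2 then (s i * \<beta> i j + s j * cnj (\<beta> j i)) / (s j ^ 2 - s i ^ 2) else 0)" for i j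
  define b where "b i j = \<beta> i j - p i j * s j + s i * q i j" for i j
  have skew: "p i j + cnj (p j i) = 0 \<and> q i j + cnj (q j i) = 0" for i j
  proof (cases "s i ^ 2 = s j ^ 2")
    case True
    then have "s i = 0 \<longleftrightarrow> s j = 0" by (metis zero_eq_power2)
    then show ?thesis using True by (auto simp: p_def q_def field_simps)
  next
    case False
    define d where "d = s j ^ 2 - s i ^ 2"
    have d: "d \<noteq> 0" "s i ^ 2 - s j ^ 2 = - d" using False by (auto simp: d_def)
    have cd: "cnj d = d" by (simp add: d_def)
    have "p i j = (s j * \<beta> i j + s i * cnj (\<beta> j i)) / d" "p j i = (s i * \<beta> j i + s j * cnj (\<beta> i j)) / (- d)"
      "q i j = (s i * \<beta> i j + s j * cnj (\<beta> j i)) / d" "q j i = (s j * \<beta> j i + s i * cnj (\<beta> i j)) / (- d)"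
      using False unfolding p_def q_def d(2) by (auto simp: d_def)
    then have "p i j = (s j * \<beta> i j + s i * cnj (\<beta> j i)) / d" "cnj (p j i) = (s i * cnj (\<beta> j i) + s j * \<beta> i j) / (- d)"
      "q i j = (s i * \<beta> i j + s j * cnj (\<beta> j i)) / d" "cnj (q j i) = (s j * cnj (\<beta> j i) + s i * \<beta> i j) / (- d)"
      by (simp_all add: cd)
    then show ?thesis by (simp add: add.commute)
  qed
  \<comment> \<open>Entrywise, these are the two Hermitian conditions on \<open>B'\<close>.\<close>
  have bij: "s i * b i j = s j * cnj (b j i) \<and> s j * b i j = s i * cnj (b j i)" for i j
  proof (cases "s i ^ 2 = s j ^ 2")
    case True
    show ?thesis
    proof (cases "s i = 0")
      case True
      then show ?thesis using \<open>s i ^ 2 = s j ^ 2\<close> by simp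
    next
      case False
      then have sj: "s j \<noteq> 0" using True by auto
      have e1: "b i j = (s i * \<beta> i j + s j * cnj (\<beta> j i)) / (2 * s i)"
        using False sj True by (simp add: b_def p_def q_def field_simps)
      have "b j i = (s j * \<beta> j i + s i * cnj (\<beta> i j)) / (2 * s j)"
        using False sj True by (simp add: b_def p_def q_def field_simps)
      then have e2: "cnj (b j i) = (s j * cnj (\<beta> j i) + s i * \<beta> i j) / (2 * s j)" by simp
      \<comment> \<open>The diagonal may have negative entries, so equal squares leave two
        cases.\<close>
      have "s i = s j \<or> s i = - s j" using True by (simp add: power2_eq_iff)
      then show ?thesis unfolding e1 e2 using False sj by (elim disjE) (simp_all add: field_simps)
    qed
  next
    case False
    have z: "b i j = 0" if "s i ^ 2 \<noteq> s j ^ 2" for i j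
    proof -
      define d where "d = s j ^ 2 - s i ^ 2"
      have d: "d \<noteq> 0" using that by (auto simp: d_def)
      have "b i j = \<beta> i j - (s j * \<beta> i j + s i * cnj (\<beta> j i)) / d * s j + s i * ((s i * \<beta> i j + s j * cnj (\<beta> j i)) / d)"
        using that unfolding b_def p_def q_def d_def by simp
      also have "\<dots> = \<beta> i j * (d - (s j ^ 2 - s i ^ 2)) / d"
        using d by (simp add: field_simps power2_eq_square)
      finally show ?thesis by (simp add: d_def)
    qed
    from z[OF False] z[OF False[symmetric]] show ?thesis by simp
  qed
  define P where "P = mat m m (\<lambda>(i, j). p i j)"
  define Q where "Q = mat n n (\<lambda>(i, j). q i j)"
  define B' where "B' = mat m n (\<lambda>(i, j). b i j)"
  have cq: "cnj (q j i) = - q i j" for i j using skew[of i j] by (simp add: eq_neg_iff_add_eq_0 add.commute)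
  show thesis
  proof (rule that[of P Q B'])
    show "P + ctrans P = 0\<^sub>m m m" "Q + ctrans Q = 0\<^sub>m n n"
      by (auto intro!: eq_matI simp: P_def Q_def skew)
    show "B = S * ctrans Q + (B' + P * S)"
      unfolding S using B
      by (intro eq_matI)
        (auto simp: P_def Q_def B'_def mult_dmat_index dmat_mult_index s0 cq b_def \<beta>_def simp del: index_mult_mat(1))
    show "ctrans B' * S = ctrans S * B'"
    proof (rule eq_matI)
      fix i j assume "i < dim_row (ctrans S * B')" "j < dim_col (ctrans S * B')"
      then have ij: "i < n" "j < n" by (simp_all add: S B'_def)
      have "(ctrans B' * S) $$ (i, j) = s j * cnj (b j i)"
        using ij by (cases "j < m") (simp_all add: S mult_dmat_index B'_def s0 del: index_mult_mat(1))
      moreover have "(ctrans S * B') $$ (i, j) = s i * b i j"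
        using ij by (cases "i < m") (simp_all add: S ctrans_dmat dmat_mult_index B'_def s0 del: index_mult_mat(1))
      ultimately show "(ctrans B' * S) $$ (i, j) = (ctrans S * B') $$ (i, j)" using bij[of i j] by simp
    qed (simp_all add: S B'_def)
    show "B' * ctrans S = S * ctrans B'"
    proof (rule eq_matI)
      fix i j assume "i < dim_row (S * ctrans B')" "j < dim_col (S * ctrans B')"
      then have ij: "i < m" "j < m" by (simp_all add: S B'_def)
      have "(B' * ctrans S) $$ (i, j) = s j * b i j"
        using ij by (cases "j < n") (simp_all add: S ctrans_dmat mult_dmat_index B'_def s0 del: index_mult_mat(1))
      moreover have "(S * ctrans B') $$ (i, j) = s i * cnj (b j i)"
        using ij by (cases "i < n") (simp_all add: S dmat_mult_index B'_def s0 del: index_mult_mat(1))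
      ultimately show "(B' * ctrans S) $$ (i, j) = (S * ctrans B') $$ (i, j)" using bij[of i j] by simp
    qed (simp_all add: S B'_def)
  qed (auto simp: P_def Q_def B'_def)
qed

lemma dequiv_real_diagonal:
  assumes A: "A \<in> dcarrier m n"
  obtains f g where "dequiv m n A (dmat m n (\<lambda>i. complex_of_real (f i)), dmat m n (\<lambda>i. complex_of_real (g i)))"
proof -
  have As: "fst A \<in> carrier_mat m n" "snd A \<in> carrier_mat m n" using A by (auto simp: dcarrier_def)
  \<comment> \<open>With zero as second matrix both conditions are trivial, and an ordinary SVD of
    the standard part results.\<close>
  obtain U V f0 where U: "cunitary m U" and V: "cunitary n V"
    and UV: "fst A = U * dmat m n (\<lambda>i. complex_of_real (f0 i)) * ctrans V"
    using simultaneous_svd[OF As(1) zero_carrier_mat] As(1) by (fastforce simp: zero_mult_dim mult_zero_dim)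
  define S where "S = dmat m n (\<lambda>i. complex_of_real (f0 i))"
  define B where "B = ctrans U * snd A * V"
  have S: "S \<in> carrier_mat m n" by (simp add: S_def carrier_matI)
  have B: "B \<in> carrier_mat m n" 
    using As(2) by (intro carrier_matI) (simp_all add: B_def cunitaryD(1,2)[OF U] cunitaryD(1,2)[OF V])
  have "A = (U * S * ctrans V, U * B * ctrans V)"
    using UV cunitary_conj_cancel[OF U V As(2)] by (cases A) (simp add: S_def B_def)
  then have 1: "dequiv m n A (S, B)" using dequiv_const[OF U V, of "(S, B)"] S B by (simp add: dcarrier_def)
  obtain P Q B' where PQ: "P \<in> carrier_mat m m" "P + ctrans P = 0\<^sub>m m m" "Q \<in> carrier_mat n n" "Q + ctrans Q = 0\<^sub>m n n"
    and B': "B' \<in> carrier_mat m n" and BS: "B = S * ctrans Q + (B' + P * S)"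
    and h: "ctrans B' * S = ctrans S * B'" "B' * ctrans S = S * ctrans B'"
    by (rule tangent_normal_decomposition[OF B S_def])
  have 2: "dequiv m n (S, B) (S, B')" by (rule dequiv_skew[OF PQ S B' BS])
  \<comment> \<open>\<open>S\<close> is diagonal already, but \<open>B'\<close> may not be.
    Diagonalising again, now jointly, treats both.\<close>
  obtain U1 V1 f g where U1: "cunitary m U1" and V1: "cunitary n V1"
    and SB: "S = U1 * dmat m n (\<lambda>i. complex_of_real (f i)) * ctrans V1"
      "B' = U1 * dmat m n (\<lambda>i. complex_of_real (g i)) * ctrans V1"
    using simultaneous_svd[OF S B' h] by blast
  let ?D = "(dmat m n (\<lambda>i. complex_of_real (f i)), dmat m n (\<lambda>i. complex_of_real (g i)))"
  have "?D \<in> dcarrier m n" by (simp add: dcarrier_iff ddim_defs)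
  from dequiv_const[OF U1 V1 this] have 3: "dequiv m n (S, B') ?D"
    unfolding fst_conv snd_conv SB[symmetric] .
  show thesis by (rule that[OF dequiv_trans[OF 1 dequiv_trans[OF 2 3]]])
qed

section \<open>Signs and order of the diagonal entries\<close>

text \<open>The permutation reads off a sorted list of indices and is the identity from
  \<open>k\<close> on.\<close>

lemma descending_permutation:
  fixes key :: "nat \<Rightarrow> 'b::linorder"
  obtains \<pi> where "\<pi> permutes {..<k}" "\<And>i j. i \<le> j \<Longrightarrow> j < k \<Longrightarrow> key (\<pi> j) \<le> key (\<pi> i)"
proof -
  define xs where "xs = rev (sort_key key [0..<k])"
  define \<pi> where "\<pi> i = (if i < k then xs ! i else i)" for i
  have xs: "length xs = k" "distinct xs" "set xs = {..<k}" by (auto simp: xs_def)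
  have "bij_betw ((!) xs) {..<k} {..<k}" by (rule bij_betw_nth[OF xs(2)]) (simp_all add: xs)
  then have "bij_betw \<pi> {..<k} {..<k}" by (rule bij_betw_cong[THEN iffD1, rotated]) (simp add: \<pi>_def)
  then have "\<pi> permutes {..<k}" by (rule bij_imp_permutes) (simp add: \<pi>_def)
  moreover have "key (\<pi> j) \<le> key (\<pi> i)" if "i \<le> j" "j < k" for i j
  proof -
    have "sorted (rev (map key xs))" by (simp add: xs_def rev_map)
    then have "map key xs ! j \<le> map key xs ! i"
      using that xs(1) by (metis length_map sorted_rev_nth_mono)
    then show ?thesis using that xs(1) by (simp add: \<pi>_def)
  qed
  ultimately show thesis by (rule that)
qed

definition perm_mat :: "nat \<Rightarrow> (nat \<Rightarrow> nat) \<Rightarrow> complex mat" where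
  "perm_mat n \<pi> = mat n n (\<lambda>(i, j). if i = \<pi> j then 1 else 0)"

lemma cunitary_perm_mat:
  assumes "\<pi> permutes {..<n}"
  shows "cunitary n (perm_mat n \<pi>)"
proof -
  have c: "perm_mat n \<pi> \<in> carrier_mat n n" by (simp add: perm_mat_def)
  have lt: "\<pi> i < n" if "i < n" for i using permutes_in_image[OF assms, of i] that by simp
  have inj: "\<pi> i = \<pi> j \<longleftrightarrow> i = j" for i j using permutes_inj[OF assms] by (auto dest: injD)
  have "ctrans (perm_mat n \<pi>) * perm_mat n \<pi> = 1\<^sub>m n"
  proof (rule eq_matI)
    fix i j assume "i < dim_row (1\<^sub>m n :: complex mat)" "j < dim_col (1\<^sub>m n :: complex mat)"
    then have ij: "i < n" "j < n" by simp_all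
    have "(ctrans (perm_mat n \<pi>) * perm_mat n \<pi>) $$ (i, j) =
        (\<Sum>k<n. cnj (if k = \<pi> i then 1 else 0) * (if k = \<pi> j then 1 else 0))"
      using ij by (simp add: index_mult_mat_sum perm_mat_def del: index_mult_mat(1))
    also have "\<dots> = (\<Sum>k<n. if k = \<pi> i then (if \<pi> i = \<pi> j then 1 else 0) else 0)"
      by (intro sum.cong) auto
    also have "\<dots> = 1\<^sub>m n $$ (i, j)" using ij lt by (simp add: inj)
    finally show "(ctrans (perm_mat n \<pi>) * perm_mat n \<pi>) $$ (i, j) = 1\<^sub>m n $$ (i, j)" .
  qed (simp_all add: perm_mat_def)
  then show ?thesis
    using c mat_mult_left_right_inverse[of "ctrans (perm_mat n \<pi>)" n "perm_mat n \<pi>"] by (simp add: cunitary_def)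
qed

text \<open>Fixing all indices from \<open>min m n\<close> on, \<pi> permutes rows and columns
  alike, though their numbers may differ. The proof checks that the permutation matrices intertwine
  the two diagonals and then cancels the right one.\<close>

lemma dmat_permute:
  assumes p: "\<pi> permutes {..<min m n}"
  shows "dmat m n f = perm_mat m \<pi> * dmat m n (\<lambda>i. f (\<pi> i)) * ctrans (perm_mat n \<pi>)"
proof -
  have d: "dim_row (perm_mat k \<pi>) = k" "dim_col (perm_mat k \<pi>) = k" for k by (simp_all add: perm_mat_def)
  have n: "cunitary n (perm_mat n \<pi>)"
    by (rule cunitary_perm_mat[OF permutes_subset[OF p]]) auto
  have lt: "\<pi> i < min m n \<longleftrightarrow> i < min m n" for i using permutes_in_image[OF p, of i] by simp
  have fix_out: "\<pi> i = i" if "\<not> i < min m n" for i using permutes_not_in[OF p, of i] that by simp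
  have "perm_mat m \<pi> * dmat m n (\<lambda>i. f (\<pi> i)) = dmat m n f * perm_mat n \<pi>"
  proof (rule eq_matI)
    fix i j assume "i < dim_row (dmat m n f * perm_mat n \<pi>)" "j < dim_col (dmat m n f * perm_mat n \<pi>)"
    then have ij: "i < m" "j < n" by (simp_all add: d)
    show "(perm_mat m \<pi> * dmat m n (\<lambda>i. f (\<pi> i))) $$ (i, j) = (dmat m n f * perm_mat n \<pi>) $$ (i, j)"
      using ij lt[of j] fix_out[of j]
      by (cases "j < min m n") (auto simp: mult_dmat_index dmat_mult_index d perm_mat_def simp del: index_mult_mat(1))
  qed (simp_all add: d)
  then show ?thesis by (simp add: mult_assoc_dim d cunitaryD[OF n])
qed

lemma dual_svd_exists:
  assumes A: "A \<in> dcarrier m n"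
  obtains U S V where "dual_svd m n A U S V"
proof -
  obtain f0 g0 where 1: "dequiv m n A (dmat m n (\<lambda>i. complex_of_real (f0 i)), dmat m n (\<lambda>i. complex_of_real (g0 i)))"
    by (rule dequiv_real_diagonal[OF A])
  \<comment> \<open>The lexicographic order on pairs is the order on dual reals. Negative dual
    entries get the sign -1, applied to both components at once.\<close>
  define h :: "nat \<Rightarrow> real" where "h i = (if (f0 i, g0 i) < (0, 0) then - 1 else 1)" for i
  define f1 where "f1 i = h i * f0 i" for i
  define g1 where "g1 i = h i * g0 i" for i
  have hh: "h i * h i = 1" for i by (simp add: h_def)
  have pos: "(0, 0) \<le> (f1 i, g1 i)" for i by (auto simp: f1_def g1_def h_def less_eq_prod_def less_prod_def)
  obtain \<pi> where \<pi>: "\<pi> permutes {..<min m n}"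
    and desc: "\<And>i j. i \<le> j \<Longrightarrow> j < min m n \<Longrightarrow> (f1 (\<pi> j), g1 (\<pi> j)) \<le> (f1 (\<pi> i), g1 (\<pi> i))"
    by (rule descending_permutation[of "min m n" "\<lambda>i. (f1 i, g1 i)"]) blast
  define f where "f i = f1 (\<pi> i)" for i
  define g where "g i = g1 (\<pi> i)" for i
  let ?d = "\<lambda>f. dmat m n (\<lambda>i. complex_of_real (f i))"
  define H where "H = dmat n n (\<lambda>i. complex_of_real (h i))"
  have Hd: "H \<in> carrier_mat n n" by (simp add: H_def dmat_def)
  have cH: "ctrans H = H" by (simp add: H_def ctrans_dmat)
  have "H * H = 1\<^sub>m n" unfolding H_def dmat_mult_dmat
    by (intro eq_matI) (auto simp: dmat_def hh simp flip: of_real_mult)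
  then have H: "cunitary n H" using Hd by (simp add: cunitary_def cH)
  \<comment> \<open>The signs are absorbed into the right unitary factor \<open>H\<close>, which is
    its own inverse.\<close>
  have sgn: "?d x = 1\<^sub>m m * ?d (\<lambda>i. h i * x i) * ctrans H" for x
    unfolding cH unfolding H_def
    by (simp add: dmat_mult_dmat) (rule dmat_cong, simp add: mult.assoc[symmetric] hh mult.commute flip: of_real_mult)
  have D: "(?d f, ?d g) \<in> dcarrier m n" for f g by (simp add: dcarrier_iff ddim_defs)
  have 2: "dequiv m n (?d f0, ?d g0) (?d f1, ?d g1)"
    using dequiv_const[OF cunitary_one H D[of f1 g1]]
    unfolding fst_conv snd_conv f1_def g1_def sgn[symmetric] by simp
  have m: "cunitary m (perm_mat m \<pi>)" and n: "cunitary n (perm_mat n \<pi>)"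
    by (rule cunitary_perm_mat[OF permutes_subset[OF \<pi>]]; auto)+
  have 3: "dequiv m n (?d f1, ?d g1) (?d f, ?d g)"
    using dequiv_const[OF m n D[of f g]]
    unfolding fst_conv snd_conv f_def g_def
      dmat_permute[OF \<pi>, of "\<lambda>i. complex_of_real (f1 i)", symmetric]
      dmat_permute[OF \<pi>, of "\<lambda>i. complex_of_real (g1 i)", symmetric] .
  obtain U V where UV: "dunitary m U" "dunitary n V" "A = U **\<^sub>d (?d f, ?d g) **\<^sub>d dstar V"
    using dequiv_trans[OF 1 dequiv_trans[OF 2 3]] unfolding dequiv_def by blast
  have pos: "f i > 0 \<or> f i = 0 \<and> g i \<ge> 0" for i
    using pos[of "\<pi> i"] by (auto simp: f_def g_def less_eq_prod_def)
  have desc: "f j < f i \<or> f j = f i \<and> g j \<le> g i" if "i \<le> j" "j < min m n" for i j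
    using desc[OF that] by (auto simp: f_def g_def less_eq_prod_def)
  \<comment> \<open>The first positions at which the standard part, respectively the whole entry,
    vanishes; the disjunct with \<open>min m n\<close> guarantees that such a position
    exists.\<close>
  define r where "r = (LEAST i. i \<ge> min m n \<or> f i = 0)"
  define t where "t = (LEAST i. i \<ge> min m n \<or> f i = 0 \<and> g i = 0)"
  have rP: "r \<ge> min m n \<or> f r = 0" unfolding r_def by (rule LeastI[of _ "min m n"]) simp
  have tP: "t \<ge> min m n \<or> f t = 0 \<and> g t = 0" unfolding t_def by (rule LeastI[of _ "min m n"]) simp
  have t_le: "t \<le> min m n" unfolding t_def by (rule Least_le) simp
  have r_le: "r \<le> t" unfolding r_def by (rule Least_le) (use tP in auto)
  have below_r: "i < min m n \<and> f i \<noteq> 0" if "i < r" for i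
    using not_less_Least[of i "\<lambda>i. i \<ge> min m n \<or> f i = 0"] that unfolding r_def by auto
  have below_t: "i < min m n \<and> \<not> (f i = 0 \<and> g i = 0)" if "i < t" for i
    using not_less_Least[of i "\<lambda>i. i \<ge> min m n \<or> f i = 0 \<and> g i = 0"] that unfolding t_def by auto
  have i1: "f i > 0" if "i < r" for i using below_r[OF that] pos[of i] by auto
  \<comment> \<open>From \<open>r\<close> on the standard parts are zero, being nonnegative and
    descending, so a nonzero entry must have positive dual part.\<close>
  have i2: "f i = 0 \<and> g i > 0" if "r \<le> i" "i < t" for i
    using below_t[OF that(2)] desc[of r i] pos[of i] rP that by auto
  have i3: "f i = 0 \<and> g i = 0" if "t \<le> i" "i < min m n" for i
    using tP desc[of t i] pos[of i] that by auto
  have "dual_svd m n A U (?d f, ?d g) V"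
    unfolding dual_svd_def
  proof (intro conjI UV D; (rule exI[of _ r], rule exI[of _ t], intro conjI r_le t_le)?)
    show "\<forall>i j. i \<le> j \<and> j < t \<longrightarrow>
        dreal_le (Re (fst (?d f, ?d g) $$ (j, j)), Re (snd (?d f, ?d g) $$ (j, j)))
          (Re (fst (?d f, ?d g) $$ (i, i)), Re (snd (?d f, ?d g) $$ (i, i)))"
    proof (intro allI impI)
      fix i j assume ij: "i \<le> j \<and> j < t"
      then have "i < m" "i < n" "j < m" "j < n" "j < min m n" using t_le by auto
      then show "dreal_le (Re (fst (?d f, ?d g) $$ (j, j)), Re (snd (?d f, ?d g) $$ (j, j)))
          (Re (fst (?d f, ?d g) $$ (i, i)), Re (snd (?d f, ?d g) $$ (i, i)))"
        using desc[of i j] ij by (auto simp: index_dmat dreal_le_def dreal_less_def)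
    qed
  qed (use i1 i2 i3 r_le t_le in \<open>auto simp: index_dmat dentry_def\<close>)
  then show thesis by (rule that)
qed

section \<open>The dual Moore--Penrose inverse\<close>

text \<open>From \<open>A X = (A Y) (A X)\<close>, taking adjoints of the Hermitian factors gives
  \<open>A X = A Y\<close>; dually \<open>X A = Y A\<close>. Hence
  \<open>X = X A X = Y A X = Y A Y = Y\<close>.\<close>

lemma is_DMPGI_unique:
  assumes A: "A \<in> dcarrier m n" and X: "is_DMPGI m n A X" and Y: "is_DMPGI m n A Y"
  shows "X = Y"
proof -
  have d: "dwf A" "drow A = m" "dcol A = n" "dwf X" "drow X = n" "dcol X = m" "dwf Y" "drow Y = n" "dcol Y = m"
    using assms by (auto simp: is_DMPGI_def dcarrier_iff)
  have x: "A **\<^sub>d X **\<^sub>d A = A" "X **\<^sub>d A **\<^sub>d X = X" "dstar (A **\<^sub>d X) = A **\<^sub>d X" "dstar (X **\<^sub>d A) = X **\<^sub>d A"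
    and y: "A **\<^sub>d Y **\<^sub>d A = A" "Y **\<^sub>d A **\<^sub>d Y = Y" "dstar (A **\<^sub>d Y) = A **\<^sub>d Y" "dstar (Y **\<^sub>d A) = Y **\<^sub>d A"
    using X Y by (simp_all add: is_DMPGI_def)
  have "A **\<^sub>d X = (A **\<^sub>d Y) **\<^sub>d (A **\<^sub>d X)" using arg_cong[OF y(1), of "\<lambda>Z. Z **\<^sub>d X"] by (simp add: dmult_assoc d)
  also have "\<dots> = dstar ((A **\<^sub>d X) **\<^sub>d (A **\<^sub>d Y))"
    by (subst dstar_dmult) (simp_all add: d x(3) y(3))
  also have "(A **\<^sub>d X) **\<^sub>d (A **\<^sub>d Y) = A **\<^sub>d Y" using arg_cong[OF x(1), of "\<lambda>Z. Z **\<^sub>d Y"] by (simp add: dmult_assoc d)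
  finally have AXY: "A **\<^sub>d X = A **\<^sub>d Y" by (simp add: y(3))
  have "X **\<^sub>d A = (X **\<^sub>d A) **\<^sub>d (Y **\<^sub>d A)" using arg_cong[OF y(1), of "\<lambda>Z. X **\<^sub>d Z"] by (simp add: dmult_assoc d)
  also have "\<dots> = dstar ((Y **\<^sub>d A) **\<^sub>d (X **\<^sub>d A))"
    by (subst dstar_dmult) (simp_all add: d x(4) y(4))
  also have "(Y **\<^sub>d A) **\<^sub>d (X **\<^sub>d A) = Y **\<^sub>d A" using arg_cong[OF x(1), of "\<lambda>Z. Y **\<^sub>d Z"] by (simp add: dmult_assoc d)
  finally have XAY: "X **\<^sub>d A = Y **\<^sub>d A" by (simp add: y(4))
  have "X = X **\<^sub>d A **\<^sub>d X" by (simp add: x(2))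
  also have "\<dots> = Y **\<^sub>d (A **\<^sub>d X)" unfolding XAY by (simp add: dmult_assoc d)
  also have "\<dots> = Y" unfolding AXY using y(2) by (simp add: dmult_assoc d)
  finally show ?thesis .
qed

lemma is_DMPGI_unitary:
  assumes U: "dunitary m U" and V: "dunitary n V" and S: "S \<in> dcarrier m n" and Y: "is_DMPGI m n S Y"
  shows "is_DMPGI m n (U **\<^sub>d S **\<^sub>d dstar V) (V **\<^sub>d Y **\<^sub>d dstar U)"
proof -
  have d: "dwf S" "drow S = m" "dcol S = n" "dwf Y" "drow Y = n" "dcol Y = m"
    using S Y by (auto simp: is_DMPGI_def dcarrier_iff)
  have y: "S **\<^sub>d Y **\<^sub>d S = S" "Y **\<^sub>d S **\<^sub>d Y = Y" "dstar (S **\<^sub>d Y) = S **\<^sub>d Y" "dstar (Y **\<^sub>d S) = Y **\<^sub>d S"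
    using Y by (simp_all add: is_DMPGI_def)
  note D = dunitaryD[OF U] dunitaryD[OF V] d
  let ?A = "U **\<^sub>d S **\<^sub>d dstar V" and ?X = "V **\<^sub>d Y **\<^sub>d dstar U"
  have AX: "?A **\<^sub>d ?X = U **\<^sub>d (S **\<^sub>d Y) **\<^sub>d dstar U" by (simp add: dmult_assoc D)
  have XA: "?X **\<^sub>d ?A = V **\<^sub>d (Y **\<^sub>d S) **\<^sub>d dstar V" by (simp add: dmult_assoc D)
  have "?A **\<^sub>d ?X **\<^sub>d ?A = U **\<^sub>d (S **\<^sub>d Y **\<^sub>d S) **\<^sub>d dstar V" unfolding AX by (simp add: dmult_assoc D)
  moreover have "?X **\<^sub>d ?A **\<^sub>d ?X = V **\<^sub>d (Y **\<^sub>d S **\<^sub>d Y) **\<^sub>d dstar U" unfolding XA by (simp add: dmult_assoc D)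
  moreover have "dstar (?A **\<^sub>d ?X) = U **\<^sub>d dstar (S **\<^sub>d Y) **\<^sub>d dstar U"
    unfolding AX by (simp add: dmult_assoc dstar_dmult D)
  moreover have "dstar (?X **\<^sub>d ?A) = V **\<^sub>d dstar (Y **\<^sub>d S) **\<^sub>d dstar V"
    unfolding XA by (simp add: dmult_assoc dstar_dmult D)
  ultimately show ?thesis
    unfolding is_DMPGI_def y AX[symmetric] XA[symmetric] by (simp add: dcarrier_iff D)
qed

section \<open>Diagonal dual matrices\<close>

lemma is_DMPGI_dmat:
  fixes f g :: "nat \<Rightarrow> complex"
  assumes r: "r \<le> min m n" and nz: "\<And>i. i < r \<Longrightarrow> f i \<noteq> 0"
    and z: "\<And>i. r \<le> i \<Longrightarrow> i < min m n \<Longrightarrow> f i = 0 \<and> g i = 0"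
  shows "is_DMPGI m n (dmat m n f, dmat m n g)
    (dmat n m (\<lambda>i. if i < r then inverse (f i) else 0),
     dmat n m (\<lambda>i. if i < r then - inverse (f i * f i) * g i else 0))"
    (is "is_DMPGI m n ?S (?Y1, ?Y2)")
proof -
  let ?Y = "(?Y1, ?Y2)"
  let ?e = "\<lambda>i. if i < r then 1 else 0 :: complex"
  have out: "f i = 0 \<and> g i = 0" if "\<not> i < r" "i < m" "i < n" for i using z[of i] that by simp
  \<comment> \<open>The dual parts of \<mu> and its inverse cancel in the product, leaving the
    constant projection onto the first \<open>r\<close> coordinates.\<close>
  have SY: "?S **\<^sub>d ?Y = (dmat m m ?e, dmat m m (\<lambda>i. 0))"
    using r nz by (auto simp: dmult_def dmat_mult_dmat dmat_add_dmat field_simps intro!: dmat_cong)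
  have YS: "?Y **\<^sub>d ?S = (dmat n n ?e, dmat n n (\<lambda>i. 0))"
    using r nz by (auto simp: dmult_def dmat_mult_dmat dmat_add_dmat field_simps intro!: dmat_cong)
  have "?S **\<^sub>d ?Y **\<^sub>d ?S = ?S"
    unfolding SY using out by (auto simp: dmult_def dmat_mult_dmat dmat_add_dmat intro!: dmat_cong)
  moreover have "?Y **\<^sub>d ?S **\<^sub>d ?Y = ?Y"
    unfolding YS by (auto simp: dmult_def dmat_mult_dmat dmat_add_dmat intro!: dmat_cong)
  moreover have "dstar (?S **\<^sub>d ?Y) = ?S **\<^sub>d ?Y" "dstar (?Y **\<^sub>d ?S) = ?Y **\<^sub>d ?S"
    unfolding SY YS by (auto simp: dstar_def ctrans_dmat intro!: dmat_cong)
  moreover have "?Y \<in> dcarrier n m" by (simp add: dcarrier_iff ddim_defs)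
  ultimately show ?thesis unfolding is_DMPGI_def by blast
qed

text \<open>Every term in the dual part of the entry \<open>(i, i)\<close> of
  \<open>\<Sigma> Y \<Sigma>\<close> contains the factor \<open>f i\<close>.\<close>

lemma dmat_no_infinitesimal_if_DMPGI:
  assumes Y: "is_DMPGI m n (dmat m n f, dmat m n g) Y" and i: "i < m" "i < n" and f: "f i = 0"
  shows "g i = 0"
proof -
  have d: "dim_row (fst Y) = n" "dim_col (fst Y) = m" "dim_row (snd Y) = n" "dim_col (snd Y) = m"
    using Y by (auto simp: is_DMPGI_def dcarrier_def)
  have "g i = snd ((dmat m n f, dmat m n g) **\<^sub>d Y **\<^sub>d (dmat m n f, dmat m n g)) $$ (i, i)"
    using Y i by (simp add: is_DMPGI_def index_dmat)
  also have "\<dots> = 0"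
    using i f d by (simp add: dmult_def mult_dmat_index dmat_mult_index mult_assoc_dim add_mult_dim del: index_mult_mat(1))
  finally show ?thesis .
qed

section \<open>From diagonal matrices back to an arbitrary SVD\<close>

lemma dual_svd_eq_dmat:
  assumes "dual_svd m n A U S V"
  shows "S = (dmat m n (\<lambda>i. fst S $$ (i, i)), dmat m n (\<lambda>i. snd S $$ (i, i)))"
proof -
  have c: "fst S \<in> carrier_mat m n" "snd S \<in> carrier_mat m n"
    and z: "\<forall>i<m. \<forall>j<n. i \<noteq> j \<longrightarrow> dentry S i j = (0, 0)"
    using assms by (auto simp: dual_svd_def dcarrier_def)
  have "fst S = dmat m n (\<lambda>i. fst S $$ (i, i))" "snd S = dmat m n (\<lambda>i. snd S $$ (i, i))"
    using c z by (auto intro!: eq_matI simp: index_dmat dentry_def)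
  then show ?thesis by (metis prod.collapse)
qed

lemma sigma_r_pinv_eq_dmat:
  "sigma_r_pinv m n r S = (dmat n m (\<lambda>i. if i < r then inverse (fst S $$ (i, i)) else 0),
     dmat n m (\<lambda>i. if i < r then - inverse (fst S $$ (i, i) * fst S $$ (i, i)) * snd S $$ (i, i) else 0))"
  by (auto simp: sigma_r_pinv_def dmat_def intro!: eq_matI)

lemma is_DMPGI_of_dual_svd:
  assumes svd: "dual_svd m n A U S V" and r: "r \<le> min m n"
    and nz: "\<forall>i<r. appreciable (dentry S i i)"
    and z: "\<forall>i. r \<le> i \<and> i < min m n \<longrightarrow> dentry S i i = (0, 0)"
  shows "is_DMPGI m n A (V **\<^sub>d sigma_r_pinv m n r S **\<^sub>d dstar U)"
proof -
  have U: "dunitary m U" and V: "dunitary n V" and S: "S \<in> dcarrier m n" and A: "A = U **\<^sub>d S **\<^sub>d dstar V"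
    using svd by (auto simp: dual_svd_def)
  have "is_DMPGI m n S (sigma_r_pinv m n r S)"
    unfolding sigma_r_pinv_eq_dmat
    by (subst (1) dual_svd_eq_dmat[OF svd], rule is_DMPGI_dmat[OF r])
      (use nz z in \<open>auto simp: appreciable_def dentry_def\<close>)
  then show ?thesis unfolding A by (rule is_DMPGI_unitary[OF U V S])
qed

lemma appreciable_if_DMPGI:
  assumes svd: "dual_svd m n A U S V" and X: "is_DMPGI m n A X"
    and i: "i < min m n" "dentry S i i \<noteq> (0, 0)"
  shows "appreciable (dentry S i i)"
proof (rule ccontr)
  assume "\<not> appreciable (dentry S i i)"
  then have f: "fst S $$ (i, i) = 0" by (simp add: appreciable_def dentry_def)
  have U: "dunitary m U" and V: "dunitary n V" and S: "S \<in> dcarrier m n" and A: "A = U **\<^sub>d S **\<^sub>d dstar V"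
    using svd by (auto simp: dual_svd_def)
  note D = dunitaryD[OF U] dunitaryD[OF V]
  have "A \<in> dcarrier m n" using S unfolding A by (simp add: dcarrier_iff D)
  \<comment> \<open>Undoing the unitary factors turns the inverse of \<open>A\<close> into one of
    \<open>S\<close>, to which the diagonal case applies.\<close>
  from is_DMPGI_unitary[OF dunitary_dstar[OF U] dunitary_dstar[OF V] this X]
  have "is_DMPGI m n (dstar U **\<^sub>d A **\<^sub>d V) (dstar V **\<^sub>d X **\<^sub>d U)" by simp
  moreover have "dstar U **\<^sub>d A **\<^sub>d V = S"
  proof -
    \<comment> \<open>The right unit law, obtained from the left one by taking adjoints.\<close>
    have "S **\<^sub>d dident n = S"
      using S D(11) dstar_dmult[of "dident n" "dstar S"] dident_dmult[of "dstar S" n]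
      by (simp add: dcarrier_iff) (simp add: dident_def dstar_def ddim_defs)
    then show ?thesis using S unfolding A by (simp add: dcarrier_iff dmult_assoc D)
  qed
  ultimately have "is_DMPGI m n (dmat m n (\<lambda>i. fst S $$ (i, i)), dmat m n (\<lambda>i. snd S $$ (i, i))) (dstar V **\<^sub>d X **\<^sub>d U)"
    using dual_svd_eq_dmat[OF svd] by simp
  from dmat_no_infinitesimal_if_DMPGI[OF this, of i] have "snd S $$ (i, i) = 0" using i f by simp
  then show False using f i by (simp add: dentry_def)
qed

theorem theorem5p1:
  fixes m n :: nat and A :: dcmat
  assumes "A \<in> dcarrier m n"
  shows "((\<exists>X. is_DMPGI m n A X) \<longleftrightarrow>
          (\<forall>U S V. dual_svd m n A U S V \<longrightarrow>
              (\<forall>i<min m n. dentry S i i \<noteq> (0,0) \<longrightarrow> appreciable (dentry S i i))))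
       \<and> ((\<exists>X. is_DMPGI m n A X) \<longrightarrow>
          (\<forall>U S V r. dual_svd m n A U S V \<and> r \<le> min m n \<and>
              (\<forall>i<r. appreciable (dentry S i i)) \<and>
              (\<forall>i. r \<le> i \<and> i < min m n \<longrightarrow> dentry S i i = (0,0)) \<longrightarrow>
              is_DMPGI m n A (V **\<^sub>d sigma_r_pinv m n r S **\<^sub>d dstar U) \<and>
              (\<forall>X. is_DMPGI m n A X \<longrightarrow> X = V **\<^sub>d sigma_r_pinv m n r S **\<^sub>d dstar U)))"
proof (intro conjI iffI)
  assume *: "\<forall>U S V. dual_svd m n A U S V \<longrightarrow>
              (\<forall>i<min m n. dentry S i i \<noteq> (0,0) \<longrightarrow> appreciable (dentry S i i))"
  \<comment> \<open>Existence of an SVD keeps the hypothesis from being vacuous.\<close>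
  obtain U S V where svd: "dual_svd m n A U S V" by (rule dual_svd_exists[OF assms])
  then obtain r t where rt: "r \<le> t" "t \<le> min m n" "\<forall>i<r. Re (fst S $$ (i, i)) > 0"
    "\<forall>i. r \<le> i \<and> i < t \<longrightarrow> fst S $$ (i, i) = 0 \<and> Re (snd S $$ (i, i)) > 0"
    "\<forall>i. t \<le> i \<and> i < min m n \<longrightarrow> dentry S i i = (0, 0)"
    unfolding dual_svd_def by blast
  \<comment> \<open>A nonempty infinitesimal block would have entry \<open>r\<close> nonzero but not
    appreciable.\<close>
  have "\<not> r < t"
  proof
    assume "r < t"
    then have "fst S $$ (r, r) = 0" "Re (snd S $$ (r, r)) > 0" "r < min m n" using rt by auto
    then show False using *[rule_format, OF svd, of r] by (cases "snd S $$ (r, r) = 0") (auto simp: dentry_def appreciable_def)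
  qed
  then have "r = t" using rt by simp
  moreover have "appreciable (dentry S i i)" if "i < r" for i
    using rt(3) that by (auto simp: appreciable_def dentry_def)
  ultimately show "\<exists>X. is_DMPGI m n A X"
    using is_DMPGI_of_dual_svd[OF svd, of r] rt by blast
qed (use appreciable_if_DMPGI is_DMPGI_of_dual_svd is_DMPGI_unique[OF assms] in blast)+

end
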